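(* Let $\hat\Sigma$ and $\Sigma^+$ be the matrices produced in steps (2) and (3) of DP-Thresholding. Then $$\mathbb{E}\|\hat\Sigma-\Sigma\|_2^2=O\Big(\frac{s^2\log p\,\log(1/\delta)}{n\epsilon^2}\Big)\quad\text{and}\quad \mathbb{E}\|\Sigma^+-\Sigma\|_2^2=O\Big(\frac{s^2\log p\,\log(1/\delta)}{n\epsilon^2}\Big),$$ where $\|\cdot\|_2$ is the spectral norm, the expectation is over both the samples and the algorithm's noise, and the implied constants depend only on $\sigma^2$.
   Context: Setting: $x_1,\dots,x_n$ are i.i.d. random vectors in $\mathbb{R}^p$ (high-dimensional regime $p\gg n\ge \mathrm{poly}(\log p)$) with $\mathbb{E}x_i=0$, $\|x_i\|_2\le 1$ almost surely, sub-Gaussian with parameter $\sigma^2$: $\mathbb{P}\{|v^Tx_i|>t\}\le e^{-t^2/(2\sigma^2)}$ for all $t>0$ and all unit vectors $v$. The covariance $\Sigma=(\sigma_{ij})$ lies in $\mathcal{G}_0(s)$: for each column $j$, the vector of off-diagonal entries $(\sigma_{ij})_{i\neq j}$ has at most $s$ nonzeros. $\Sigma^*=(\sigma^*_{ij})=\frac1n\sum_i x_ix_i^T$. The constant $\gamma>0$ (depending only on $\sigma^2$) is one for which there is a constant $C_1$ with $\mathbb{P}(|\sigma^*_{ij}-\sigma_{ij}|>t)\le C_1e^{-8nt^2/\gamma^2}$ for all $i,j$ and all sufficiently small $|t|$, in particular $\mathbb{P}(|\sigma^*_{ij}-\sigma_{ij}|>\gamma\sqrt{\log p/n})\le C_1p^{-8}$.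 DP-Thresholding algorithm with input $0<\epsilon,\delta\le1$: (1) $\tilde\Sigma=(\tilde\sigma_{ij})=\Sigma^*+N$, where $N$ is a symmetric $p\times p$ matrix whose upper-triangular entries (including the diagonal) are i.i.d. $\mathcal{N}(0,\sigma_1^2)$, independent of the data, with $\sigma_1^2=\frac{2\ln(1.25/\delta)}{n^2\epsilon^2}$, lower triangle copied from upper; (2) $\hat\sigma_{ij}=\tilde\sigma_{ij}\cdot\mathbb{I}[|\tilde\sigma_{ij}|>\tau]$ with $\tau=\gamma\sqrt{\frac{\log p}{n}}+\frac{4\sqrt{2\ln(1.25/\delta)}\sqrt{\log p}}{n\epsilon}$; (3) with eigendecomposition $\hat\Sigma=\sum_i\lambda_iv_iv_i^T$, output $\Sigma^+=\sum_i\max\{\lambda_i,0\}v_iv_i^T$.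
   Formalization: The bound uses log(1.25/δ) in place of log(1/δ), and s ≥ 1 is assumed: at δ = 1 or s = 0 the stated bound is zero while the expected error is positive; for δ bounded away from 1 the two logarithms agree up to a constant. *)

theory Defs
  imports "HOL-Probability.Probability"
begin

(* Vectors in R^p are functions nat => real, only indices < p matter;
   p x p matrices are functions nat => nat => real, only indices < p matter. *)

definition spec_norm :: "nat \<Rightarrow> (nat \<Rightarrow> nat \<Rightarrow> real) \<Rightarrow> real" where
  "spec_norm p A = (SUP x\<in>{x :: nat \<Rightarrow> real. (\<Sum>i<p. (x i)\<^sup>2) = 1}.
        sqrt (\<Sum>a<p. (\<Sum>b<p. A a b * x b)\<^sup>2))"

definition cov_mat :: "(nat \<Rightarrow> real) measure \<Rightarrow> nat \<Rightarrow> nat \<Rightarrow> real" where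
  "cov_mat D a b = (\<integral>x. x a * x b \<partial>D)"

definition sample_cov :: "nat \<Rightarrow> (nat \<Rightarrow> nat \<Rightarrow> real) \<Rightarrow> nat \<Rightarrow> nat \<Rightarrow> real" where
  "sample_cov n X a b = (\<Sum>k<n. X k a * X k b) / real n"

definition in_G0 :: "nat \<Rightarrow> nat \<Rightarrow> (nat \<Rightarrow> nat \<Rightarrow> real) \<Rightarrow> bool" where
  "in_G0 p s A = (\<forall>j<p. card {i. i < p \<and> i \<noteq> j \<and> A i j \<noteq> 0} \<le> s)"

definition upper_idx :: "nat \<Rightarrow> (nat \<times> nat) set" where
  "upper_idx p = {(i, j). i \<le> j \<and> j < p}"

definition sym_noise :: "(nat \<times> nat \<Rightarrow> real) \<Rightarrow> nat \<Rightarrow> nat \<Rightarrow> real" where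
  "sym_noise z a b = (if a \<le> b then z (a, b) else z (b, a))"

definition dp_sigma1 :: "nat \<Rightarrow> real \<Rightarrow> real \<Rightarrow> real" where
  "dp_sigma1 n \<epsilon> \<delta> = sqrt (2 * ln (1.25 / \<delta>)) / (real n * \<epsilon>)"

definition dp_tau :: "real \<Rightarrow> nat \<Rightarrow> nat \<Rightarrow> real \<Rightarrow> real \<Rightarrow> real" where
  "dp_tau \<gamma> n p \<epsilon> \<delta> = \<gamma> * sqrt (ln (real p) / real n)
      + 4 * sqrt (2 * ln (1.25 / \<delta>)) * sqrt (ln (real p)) / (real n * \<epsilon>)"

definition sample_space :: "(nat \<Rightarrow> real) measure \<Rightarrow> nat \<Rightarrow> (nat \<Rightarrow> nat \<Rightarrow> real) measure" where
  "sample_space D n = PiM {..<n} (\<lambda>_. D)"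

definition noise_space :: "nat \<Rightarrow> real \<Rightarrow> (nat \<times> nat \<Rightarrow> real) measure" where
  "noise_space p \<sigma>1 = PiM (upper_idx p) (\<lambda>_. density lborel (normal_density 0 \<sigma>1))"

definition dp_tilde :: "nat \<Rightarrow> (nat \<Rightarrow> nat \<Rightarrow> real) \<Rightarrow> (nat \<times> nat \<Rightarrow> real) \<Rightarrow> nat \<Rightarrow> nat \<Rightarrow> real" where
  "dp_tilde n X z a b = sample_cov n X a b + sym_noise z a b"

definition threshold :: "real \<Rightarrow> (nat \<Rightarrow> nat \<Rightarrow> real) \<Rightarrow> nat \<Rightarrow> nat \<Rightarrow> real" where
  "threshold \<tau> A a b = (if \<bar>A a b\<bar> > \<tau> then A a b else 0)"

definition dp_hat :: "real \<Rightarrow> nat \<Rightarrow> nat \<Rightarrow> real \<Rightarrow> real \<Rightarrow> (nat \<Rightarrow> nat \<Rightarrow> real) \<Rightarrow> (nat \<times> nat \<Rightarrow> real) \<Rightarrow> nat \<Rightarrow> nat \<Rightarrow> real" where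
  "dp_hat \<gamma> n p \<epsilon> \<delta> X z = threshold (dp_tau \<gamma> n p \<epsilon> \<delta>) (dp_tilde n X z)"

definition psd_part :: "nat \<Rightarrow> (nat \<Rightarrow> nat \<Rightarrow> real) \<Rightarrow> nat \<Rightarrow> nat \<Rightarrow> real" where
  "psd_part p A = (SOME M. \<exists>(v :: nat \<Rightarrow> nat \<Rightarrow> real) (lam :: nat \<Rightarrow> real).
      (\<forall>i<p. \<forall>j<p. (\<Sum>k<p. v i k * v j k) = (if i = j then 1 else 0)) \<and>
      (\<forall>a<p. \<forall>b<p. A a b = (\<Sum>i<p. lam i * v i a * v i b)) \<and>
      M = (\<lambda>a b. if a < p \<and> b < p then (\<Sum>i<p. max (lam i) 0 * v i a * v i b) else 0))"

definition dp_plus :: "real \<Rightarrow> nat \<Rightarrow> nat \<Rightarrow> real \<Rightarrow> real \<Rightarrow> (nat \<Rightarrow> nat \<Rightarrow> real) \<Rightarrow> (nat \<times> nat \<Rightarrow> real) \<Rightarrow> nat \<Rightarrow> nat \<Rightarrow> real" where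
  "dp_plus \<gamma> n p \<epsilon> \<delta> X z = psd_part p (dp_hat \<gamma> n p \<epsilon> \<delta> X z)"

end

theory Submission
  imports Defs
begin

text \<open>
  Off an event of probability \<open>O(p\<^sup>-\<^sup>4)\<close>, every entry of \<open>\<Sigma>\<^sup>*\<close> is within the first summand of
  \<open>\<tau>\<close> of the entry of \<open>\<Sigma>\<close> and every noise entry is within the second. Then thresholding kills all
  entries outside the support of \<open>\<Sigma>\<close> and changes the others by at most \<open>2\<tau>\<close>, so every column of
  the symmetric difference \<open>H - \<Sigma>\<close>, with \<open>H\<close> the thresholded matrix, has absolute sum at most
  \<open>2(s + 1)\<tau>\<close>, which bounds its spectral norm. On the exceptional event the squared Frobenius norm
  is a sum of \<open>p\<^sup>2\<close> terms with bounded moments, which is negligible since \<open>n \<le> p\<close>. Finally \<open>\<Sigma>\<close> is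
  positive semidefinite, so the negative eigenvalues of \<open>H\<close> are bounded in absolute value by the
  spectral norm of \<open>H - \<Sigma>\<close>, and removing them at most doubles the error.
\<close>

section \<open>Spectral theorem\<close>

definition dot :: "nat \<Rightarrow> (nat \<Rightarrow> real) \<Rightarrow> (nat \<Rightarrow> real) \<Rightarrow> real" where
  "dot p x y = (\<Sum>i<p. x i * y i)"

definition mulv :: "nat \<Rightarrow> (nat \<Rightarrow> nat \<Rightarrow> real) \<Rightarrow> (nat \<Rightarrow> real) \<Rightarrow> nat \<Rightarrow> real" where
  "mulv p A x a = (\<Sum>b<p. A a b * x b)"

definition quad_form :: "nat \<Rightarrow> (nat \<Rightarrow> nat \<Rightarrow> real) \<Rightarrow> (nat \<Rightarrow> real) \<Rightarrow> real" where
  "quad_form p A x = dot p x (mulv p A x)"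

definition symmetric_mat :: "nat \<Rightarrow> (nat \<Rightarrow> nat \<Rightarrow> real) \<Rightarrow> bool" where
  "symmetric_mat p A \<longleftrightarrow> (\<forall>a<p. \<forall>b<p. A a b = A b a)"

definition basis_vec :: "nat \<Rightarrow> nat \<Rightarrow> real" where
  "basis_vec j = (\<lambda>a. if a = j then 1 else 0)"

lemma dot_commute: "dot p x y = dot p y x"
  by (simp add: dot_def mult.commute)

lemma dot_cong: "(\<And>a. a < p \<Longrightarrow> x a = x' a) \<Longrightarrow> (\<And>a. a < p \<Longrightarrow> y a = y' a) \<Longrightarrow> dot p x y = dot p x' y'"
  by (simp add: dot_def)

lemma dot_add_left: "dot p (\<lambda>a. x a + y a) z = dot p x z + dot p y z"
  by (simp add: dot_def sum.distrib algebra_simps)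

lemma dot_add_right: "dot p x (\<lambda>a. y a + z a) = dot p x y + dot p x z"
  by (simp add: dot_def sum.distrib algebra_simps)

lemma dot_diff_left: "dot p (\<lambda>a. x a - y a) z = dot p x z - dot p y z"
  by (simp add: dot_def sum_subtractf algebra_simps)

lemma dot_scale_left: "dot p (\<lambda>a. c * x a) z = c * dot p x z"
  by (simp add: dot_def sum_distrib_left algebra_simps)

lemma dot_scale_right: "dot p x (\<lambda>a. c * z a) = c * dot p x z"
  by (simp add: dot_def sum_distrib_left algebra_simps)

lemma dot_sum_left: "dot p (\<lambda>a. \<Sum>i\<in>I. f i a) z = (\<Sum>i\<in>I. dot p (f i) z)"
  unfolding dot_def by (simp add: sum_distrib_right) (rule sum.swap)

lemma dot_self: "dot p x x = (\<Sum>i<p. (x i)\<^sup>2)"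
  by (simp add: dot_def power2_eq_square)

lemma dot_self_nonneg: "0 \<le> dot p x x"
  by (simp add: dot_self sum_nonneg)

lemma dot_self_eq_0: "dot p x x = 0 \<longleftrightarrow> (\<forall>i<p. x i = 0)"
  by (auto simp: dot_self sum_nonneg_eq_0_iff)

lemma dot_Cauchy_Schwarz: "(dot p x y)\<^sup>2 \<le> dot p x x * dot p y y"
  using Cauchy_Schwarz_ineq_sum[of x y "{..<p}"] by (simp add: dot_def power2_eq_square)

lemma dot_basis_vec_right: "j < p \<Longrightarrow> dot p x (basis_vec j) = x j"
  by (simp add: dot_def basis_vec_def if_distrib cong: if_cong)

lemma dot_basis_vec_left: "j < p \<Longrightarrow> dot p (basis_vec j) x = x j"
  by (simp add: dot_basis_vec_right dot_commute[of p "basis_vec j"])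

lemma mulv_cong: "(\<And>b. b < p \<Longrightarrow> x b = y b) \<Longrightarrow> mulv p A x = mulv p A y"
  by (simp add: mulv_def fun_eq_iff)

lemma mulv_add: "mulv p A (\<lambda>b. x b + y b) = (\<lambda>a. mulv p A x a + mulv p A y a)"
  by (simp add: fun_eq_iff mulv_def sum.distrib algebra_simps)

lemma mulv_scale: "mulv p A (\<lambda>b. c * x b) = (\<lambda>a. c * mulv p A x a)"
  by (simp add: fun_eq_iff mulv_def sum_distrib_left mult_ac)

lemma quad_form_cong: "(\<And>a. a < p \<Longrightarrow> x a = y a) \<Longrightarrow> quad_form p A x = quad_form p A y"
  unfolding quad_form_def by (intro dot_cong) (simp_all cong: mulv_cong)

lemma quad_form_scale: "quad_form p A (\<lambda>a. c * x a) = c\<^sup>2 * quad_form p A x"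
  by (simp add: quad_form_def mulv_scale dot_scale_left dot_scale_right power2_eq_square)

lemma dot_mulv_commute:
  assumes "symmetric_mat p A"
  shows "dot p x (mulv p A y) = dot p (mulv p A x) y"
proof -
  have "dot p x (mulv p A y) = (\<Sum>a<p. \<Sum>b<p. x a * A a b * y b)"
    by (simp add: dot_def mulv_def sum_distrib_left mult.assoc)
  also have "\<dots> = (\<Sum>b<p. \<Sum>a<p. x a * A a b * y b)"
    by (rule sum.swap)
  also have "\<dots> = (\<Sum>b<p. \<Sum>a<p. A b a * x a * y b)"
    using assms by (intro sum.cong refl) (simp add: symmetric_mat_def mult_ac)
  also have "\<dots> = dot p (mulv p A x) y"
    by (simp add: dot_def mulv_def sum_distrib_right)
  finally show ?thesis .
qed

lemma quad_form_add_scale: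
  assumes "symmetric_mat p A"
  shows "quad_form p A (\<lambda>a. x a + t * y a)
      = quad_form p A x + 2 * t * dot p (mulv p A x) y + t\<^sup>2 * quad_form p A y"
proof -
  have "dot p y (mulv p A x) = dot p (mulv p A x) y" "dot p x (mulv p A y) = dot p (mulv p A x) y"
    by (rule dot_commute, rule dot_mulv_commute[OF assms])
  then show ?thesis
    by (simp add: quad_form_def mulv_add mulv_scale dot_add_left dot_add_right dot_scale_left
        dot_scale_right algebra_simps power2_eq_square)
qed

definition orthonormal :: "nat \<Rightarrow> nat \<Rightarrow> (nat \<Rightarrow> nat \<Rightarrow> real) \<Rightarrow> bool" where
  "orthonormal p k v \<longleftrightarrow> (\<forall>i<k. \<forall>j<k. dot p (v i) (v j) = (if i = j then 1 else 0))"

definition orth_complement :: "nat \<Rightarrow> nat \<Rightarrow> (nat \<Rightarrow> nat \<Rightarrow> real) \<Rightarrow> (nat \<Rightarrow> real) set" where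
  "orth_complement p k v = {x. \<forall>i<k. dot p x (v i) = 0}"

definition residual :: "nat \<Rightarrow> nat \<Rightarrow> (nat \<Rightarrow> nat \<Rightarrow> real) \<Rightarrow> (nat \<Rightarrow> real) \<Rightarrow> nat \<Rightarrow> real" where
  "residual p k v x = (\<lambda>a. x a - (\<Sum>i<k. dot p x (v i) * v i a))"

lemma sum_dot_orthonormal:
  assumes "orthonormal p k v" "j < k"
  shows "(\<Sum>i<k. c i * dot p (v i) (v j)) = c j"
proof -
  have "(\<Sum>i<k. c i * dot p (v i) (v j)) = (\<Sum>i<k. if i = j then c i else 0)"
    using assms by (intro sum.cong) (auto simp: orthonormal_def)
  also have "\<dots> = c j" using assms(2) by simp
  finally show ?thesis .
qed

lemma dot_residual_left:
  "dot p (residual p k v x) y = dot p x y - (\<Sum>i<k. dot p x (v i) * dot p (v i) y)"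
  by (simp add: residual_def dot_diff_left dot_sum_left dot_scale_left)

lemma residual_in_orth_complement:
  "orthonormal p k v \<Longrightarrow> residual p k v x \<in> orth_complement p k v"
  by (auto simp: orth_complement_def dot_residual_left sum_dot_orthonormal[of p k v])

lemma dot_residual_self:
  assumes "orthonormal p k v"
  shows "dot p (residual p k v x) (residual p k v x) = dot p x x - (\<Sum>i<k. (dot p x (v i))\<^sup>2)"
proof -
  have orthogonal: "dot p (v i) (residual p k v x) = 0" if "i < k" for i
    using residual_in_orth_complement[OF assms, of x] that
    by (simp add: orth_complement_def dot_commute[of p "v i"])
  have "dot p (residual p k v x) (residual p k v x) = dot p x (residual p k v x)"
    by (subst dot_residual_left) (simp add: orthogonal)
  also have "\<dots> = dot p (residual p k v x) x"
    by (rule dot_commute)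
  finally show ?thesis
    by (simp add: dot_residual_left dot_commute[of p "v _" x] power2_eq_square)
qed

lemma Bessel_inequality:
  "orthonormal p k v \<Longrightarrow> (\<Sum>i<k. (dot p x (v i))\<^sup>2) \<le> dot p x x"
  using dot_residual_self[of p k v x] dot_self_nonneg[of p "residual p k v x"] by simp

text \<open>The trace of the orthogonal projection onto the complement of the \<open>v i\<close>.\<close>

lemma sum_residual_basis_vec:
  assumes "orthonormal p k v"
  shows "(\<Sum>j<p. dot p (residual p k v (basis_vec j)) (residual p k v (basis_vec j)))
    = real p - real k"
proof -
  have "(\<Sum>j<p. dot p (residual p k v (basis_vec j)) (residual p k v (basis_vec j)))
      = (\<Sum>j<p. 1 - (\<Sum>i<k. (v i j)\<^sup>2))"
    by (intro sum.cong refl)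
      (simp add: dot_residual_self[OF assms] dot_basis_vec_left, simp add: basis_vec_def)
  also have "\<dots> = real p - (\<Sum>j<p. \<Sum>i<k. (v i j)\<^sup>2)"
    by (simp add: sum_subtractf)
  also have "(\<Sum>j<p. \<Sum>i<k. (v i j)\<^sup>2) = (\<Sum>i<k. dot p (v i) (v i))"
    unfolding dot_self by (rule sum.swap)
  also have "\<dots> = real k"
    using assms by (simp add: orthonormal_def)
  finally show ?thesis .
qed

lemma ex_nonzero_orth_complement:
  assumes "orthonormal p k v" "k < p"
  shows "\<exists>x\<in>orth_complement p k v. dot p x x \<noteq> 0"
proof (rule ccontr)
  assume "\<not> ?thesis"
  then have "(\<Sum>j<p. dot p (residual p k v (basis_vec j)) (residual p k v (basis_vec j))) = 0"
    using residual_in_orth_complement[OF assms(1)] by (intro sum.neutral) blast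
  with sum_residual_basis_vec[OF assms(1)] assms(2) show False by simp
qed

lemma orthonormal_basis_columns:
  assumes "orthonormal p p v" "a < p" "b < p"
  shows "(\<Sum>i<p. v i a * v i b) = (if a = b then 1 else 0)"
proof -
  have "dot p (residual p p v (basis_vec a)) (residual p p v (basis_vec a)) = 0"
    using sum_residual_basis_vec[OF assms(1)] \<open>a < p\<close>
    by (simp add: sum_nonneg_eq_0_iff dot_self_nonneg)
  then have "residual p p v (basis_vec a) b = 0"
    using \<open>b < p\<close> by (simp add: dot_self_eq_0)
  then show ?thesis
    using \<open>a < p\<close>
    by (simp add: residual_def dot_basis_vec_left) (auto simp: basis_vec_def split: if_splits)
qed

definition unit_sphere :: "nat \<Rightarrow> (nat \<Rightarrow> real) set" where
  "unit_sphere p = {x. dot p x x = 1 \<and> (\<forall>a\<ge>p. x a = 0)}"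

lemma continuous_on_dot:
  assumes "\<And>i. continuous_on S (\<lambda>x. f x i)" "\<And>i. continuous_on S (\<lambda>x. g x i)"
  shows "continuous_on S (\<lambda>x. dot p (f x) (g x))"
  unfolding dot_def by (intro continuous_intros assms)

lemma continuous_on_quad_form: "continuous_on S (quad_form p A)"
proof (rule continuous_on_subset)
  show "continuous_on UNIV (quad_form p A)"
    unfolding quad_form_def mulv_def
    by (intro continuous_on_dot continuous_intros continuous_on_product_coordinates)
qed simp

lemma abs_coordinate_le_1:
  fixes x :: "nat \<Rightarrow> real"
  assumes "(\<Sum>i<p. (x i)\<^sup>2) \<le> 1" "a < p"
  shows "\<bar>x a\<bar> \<le> 1"
proof -
  have "(x a)\<^sup>2 \<le> (\<Sum>i<p. (x i)\<^sup>2)"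
    using assms(2) by (intro member_le_sum[of a "{..<p}" "\<lambda>i. (x i)\<^sup>2"]) auto
  with assms(1) show ?thesis by (simp add: abs_square_le_1[symmetric])
qed

lemma compact_unit_sphere: "compact (unit_sphere p)"
proof -
  define box where "box = PiE UNIV (\<lambda>a. if a < p then {-1..1} else {0 :: real})"
  have "compactin (product_topology (\<lambda>_. euclidean) UNIV) box"
    unfolding box_def by (simp add: compactin_PiE)
  then have "compact box"
    by (simp add: euclidean_product_topology)
  moreover have "closed {x. dot p x x = 1}"
    by (intro closed_Collect_eq continuous_on_dot continuous_intros
        continuous_on_product_coordinates)
  ultimately have "compact (box \<inter> {x. dot p x x = 1})"
    by (rule compact_Int_closed)
  moreover have "unit_sphere p = box \<inter> {x. dot p x x = 1}"
  proof -
    have "x a \<in> {-1..1}" if "dot p x x = 1" "a < p" for x a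
      using abs_coordinate_le_1[of x p a] that by (simp add: dot_self abs_le_iff)
    then show ?thesis
      unfolding unit_sphere_def box_def PiE_UNIV_domain by force
  qed
  ultimately show ?thesis by simp
qed

lemma closed_orth_complement: "closed (orth_complement p k v)"
proof -
  have "orth_complement p k v = (\<Inter>i\<in>{..<k}. {x. dot p x (v i) = 0})"
    by (auto simp: orth_complement_def)
  moreover have "closed {x. dot p x (v i) = 0}" for i
    by (intro closed_Collect_eq continuous_on_dot continuous_intros
        continuous_on_product_coordinates)
  ultimately show ?thesis by auto
qed

lemma ex_unit_multiple:
  assumes "dot p y y \<noteq> 0" "y \<in> orth_complement p k v"
  shows "\<exists>z \<in> unit_sphere p \<inter> orth_complement p k v. \<forall>a<p. y a = sqrt (dot p y y) * z a"
proof
  let ?r = "sqrt (dot p y y)"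
  let ?z = "\<lambda>a. if a < p then 1 / ?r * y a else 0"
  have norm_y: "?r \<noteq> 0" "?r\<^sup>2 = dot p y y"
    using assms(1) dot_self_nonneg[of p y] by auto
  have "dot p ?z w = 1 / ?r * dot p y w" for w
    unfolding dot_scale_left[symmetric] by (intro dot_cong) auto
  with assms(2) have "?z \<in> orth_complement p k v" by (simp add: orth_complement_def)
  moreover have "dot p ?z ?z = 1"
  proof -
    have "dot p ?z ?z = (\<Sum>i<p. (y i)\<^sup>2 / ?r\<^sup>2)"
      unfolding dot_self by (intro sum.cong) (auto simp: power_divide)
    then show ?thesis using norm_y assms(1) by (simp add: sum_divide_distrib[symmetric] dot_self)
  qed
  ultimately show "?z \<in> unit_sphere p \<inter> orth_complement p k v" by (simp add: unit_sphere_def)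
  show "\<forall>a<p. y a = ?r * ?z a" using norm_y by simp
qed

lemma ex_max_quad_form:
  assumes "orthonormal p k v" "k < p"
  shows "\<exists>x\<in>orth_complement p k v. dot p x x = 1 \<and>
    (\<forall>y\<in>orth_complement p k v. quad_form p A y \<le> quad_form p A x * dot p y y)"
proof -
  let ?S = "unit_sphere p \<inter> orth_complement p k v"
  have "compact ?S"
    by (intro compact_Int_closed compact_unit_sphere closed_orth_complement)
  moreover have "?S \<noteq> {}"
    using ex_nonzero_orth_complement[OF assms] ex_unit_multiple by blast
  ultimately obtain x where x: "x \<in> ?S" "\<And>z. z \<in> ?S \<Longrightarrow> quad_form p A z \<le> quad_form p A x"
    using continuous_attains_sup[OF _ _ continuous_on_quad_form] by metis
  have "quad_form p A y \<le> quad_form p A x * dot p y y" if y: "y \<in> orth_complement p k v" for y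
  proof (cases "dot p y y = 0")
    case True
    then have "quad_form p A y = 0"
      by (subst (asm) dot_self_eq_0) (simp add: quad_form_def dot_def)
    with True show ?thesis by simp
  next
    case False
    then obtain z where z: "z \<in> ?S" "\<forall>a<p. y a = sqrt (dot p y y) * z a"
      using ex_unit_multiple y by blast
    have "quad_form p A y = (sqrt (dot p y y))\<^sup>2 * quad_form p A z"
      unfolding quad_form_scale[symmetric] using z(2) by (intro quad_form_cong) blast
    then show ?thesis
      using x(2)[OF z(1)] dot_self_nonneg[of p y] by (simp add: mult.commute mult_left_mono)
  qed
  with x(1) show ?thesis by (auto simp: unit_sphere_def)
qed

lemma quadratic_nonneg_imp_linear_coeff_zero:
  fixes b c :: real
  assumes "\<And>t. 0 \<le> b * t + c * t\<^sup>2"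
  shows "b = 0"
proof (rule DERIV_local_min)
  show "((\<lambda>t. b * t + c * t\<^sup>2) has_real_derivative b) (at 0)"
    by (auto intro!: derivative_eq_intros)
  show "\<forall>t. \<bar>0 - t\<bar> < 1 \<longrightarrow> b * 0 + c * 0\<^sup>2 \<le> b * t + c * t\<^sup>2"
    using assms by simp
qed simp

lemma mulv_eq_0_of_quad_form_nonneg:
  assumes "symmetric_mat p A" "quad_form p A x = 0"
    and nonneg: "\<And>t. 0 \<le> quad_form p A (\<lambda>a. x a + t * mulv p A x a)"
    and "a < p"
  shows "mulv p A x a = 0"
proof -
  have "0 \<le> 2 * dot p (mulv p A x) (mulv p A x) * t + quad_form p A (mulv p A x) * t\<^sup>2" for t
    using nonneg[of t] assms(2) by (simp add: quad_form_add_scale[OF assms(1)] mult_ac)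
  then have "dot p (mulv p A x) (mulv p A x) = 0"
    using quadratic_nonneg_imp_linear_coeff_zero by force
  with \<open>a < p\<close> show ?thesis by (simp add: dot_self_eq_0)
qed

definition shifted_mat :: "real \<Rightarrow> (nat \<Rightarrow> nat \<Rightarrow> real) \<Rightarrow> nat \<Rightarrow> nat \<Rightarrow> real" where
  "shifted_mat l A a b = l * basis_vec b a - A a b"

lemma symmetric_mat_shifted_mat: "symmetric_mat p A \<Longrightarrow> symmetric_mat p (shifted_mat l A)"
  by (simp add: symmetric_mat_def shifted_mat_def basis_vec_def)

lemma mulv_shifted_mat:
  assumes "a < p"
  shows "mulv p (shifted_mat l A) x a = l * x a - mulv p A x a"
proof -
  have "(\<Sum>b<p. l * basis_vec b a * x b) = l * dot p (basis_vec a) x"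
    by (auto simp: dot_def sum_distrib_left basis_vec_def intro!: sum.cong)
  then show ?thesis
    using assms
    by (simp add: mulv_def shifted_mat_def left_diff_distrib sum_subtractf dot_basis_vec_left)
qed

lemma quad_form_shifted_mat: "quad_form p (shifted_mat l A) x = l * dot p x x - quad_form p A x"
proof -
  have "quad_form p (shifted_mat l A) x = dot p (\<lambda>a. l * x a - mulv p A x a) x"
    unfolding quad_form_def by (subst dot_commute) (intro dot_cong mulv_shifted_mat refl)
  then show ?thesis
    by (simp add: quad_form_def dot_diff_left dot_scale_left dot_commute[of p "mulv p A x"])
qed

lemma mulv_shifted_mat_in_orth_complement:
  assumes "symmetric_mat p A" "x \<in> orth_complement p k v"
    and eigen: "\<And>i a. i < k \<Longrightarrow> a < p \<Longrightarrow> mulv p A (v i) a = lam i * v i a"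
  shows "mulv p (shifted_mat l A) x \<in> orth_complement p k v"
  unfolding orth_complement_def
proof (intro CollectI allI impI)
  fix i assume "i < k"
  have "dot p (mulv p (shifted_mat l A) x) (v i) = dot p (mulv p (shifted_mat l A) (v i)) x"
    using dot_mulv_commute[OF symmetric_mat_shifted_mat[OF assms(1)]] dot_commute by metis
  also have "\<dots> = dot p (\<lambda>a. (l - lam i) * v i a) x"
    using eigen[OF \<open>i < k\<close>] by (intro dot_cong refl) (simp add: mulv_shifted_mat left_diff_distrib)
  also have "\<dots> = 0"
    using assms(2) \<open>i < k\<close> by (simp add: dot_scale_left orth_complement_def dot_commute[of p "v i"])
  finally show "dot p (mulv p (shifted_mat l A) x) (v i) = 0" .
qed

text \<open>For \<open>l\<close> the maximum of the form of \<open>A\<close> on unit vectors of the complement, the form of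
  \<open>l I - A\<close> is nonnegative on the complement and vanishes at the maximizer.\<close>

lemma ex_eigenvector_orth_complement:
  assumes sym: "symmetric_mat p A" and orth: "orthonormal p k v" and "k < p"
    and eigen: "\<And>i a. i < k \<Longrightarrow> a < p \<Longrightarrow> mulv p A (v i) a = lam i * v i a"
  shows "\<exists>x\<in>orth_complement p k v. \<exists>l. dot p x x = 1 \<and> (\<forall>a<p. mulv p A x a = l * x a)"
proof -
  obtain x where x: "x \<in> orth_complement p k v" "dot p x x = 1"
    and max: "\<And>y. y \<in> orth_complement p k v \<Longrightarrow> quad_form p A y \<le> quad_form p A x * dot p y y"
    using ex_max_quad_form[OF orth \<open>k < p\<close>, of A] by blast
  define l where "l = quad_form p A x"
  let ?N = "shifted_mat l A"
  have "(\<lambda>a. x a + t * mulv p ?N x a) \<in> orth_complement p k v" for t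
    using x(1) mulv_shifted_mat_in_orth_complement[OF sym x(1) eigen, of l]
    by (simp add: orth_complement_def dot_add_left dot_scale_left)
  with max have "0 \<le> quad_form p ?N (\<lambda>a. x a + t * mulv p ?N x a)" for t
    by (simp add: quad_form_shifted_mat l_def)
  moreover have "quad_form p ?N x = 0"
    using x(2) by (simp add: quad_form_shifted_mat l_def)
  ultimately have "mulv p ?N x a = 0" if "a < p" for a
    using mulv_eq_0_of_quad_form_nonneg[OF symmetric_mat_shifted_mat[OF sym]] that by blast
  then have "\<forall>a<p. mulv p A x a = l * x a"
    by (simp add: mulv_shifted_mat)
  with x show ?thesis by blast
qed

lemma ex_orthonormal_eigenvectors:
  assumes "symmetric_mat p A"
  shows "k \<le> p \<Longrightarrow> \<exists>v lam. orthonormal p k v \<and> (\<forall>i<k. \<forall>a<p. mulv p A (v i) a = lam i * v i a)"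
proof (induction k)
  case 0
  then show ?case by (simp add: orthonormal_def)
next
  case (Suc k)
  then obtain v lam where v: "orthonormal p k v" "\<forall>i<k. \<forall>a<p. mulv p A (v i) a = lam i * v i a"
    by auto
  with ex_eigenvector_orth_complement[OF assms, of k v lam] Suc.prems obtain x l where
    x: "x \<in> orth_complement p k v" "dot p x x = 1" "\<forall>a<p. mulv p A x a = l * x a"
    by (auto simp: Suc_le_eq)
  have "orthonormal p (Suc k) (v(k := x))"
    using v(1) x(1,2)
    by (auto simp: orthonormal_def orth_complement_def less_Suc_eq dot_commute[of p "v _" x])
  moreover have "\<forall>i<Suc k. \<forall>a<p. mulv p A ((v(k := x)) i) a = (lam(k := l)) i * (v(k := x)) i a"
    using v(2) x(3) by (auto simp: less_Suc_eq)
  ultimately show ?case by blast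
qed

definition rank_one_sum :: "nat \<Rightarrow> (nat \<Rightarrow> nat \<Rightarrow> real) \<Rightarrow> (nat \<Rightarrow> real) \<Rightarrow> nat \<Rightarrow> nat \<Rightarrow> real" where
  "rank_one_sum k v c a b = (\<Sum>i<k. c i * v i a * v i b)"

lemma ex_eigendecomposition:
  assumes "symmetric_mat p A"
  shows "\<exists>v lam. orthonormal p p v \<and> (\<forall>a<p. \<forall>b<p. A a b = rank_one_sum p v lam a b)"
proof -
  obtain v lam where v: "orthonormal p p v" "\<forall>i<p. \<forall>a<p. mulv p A (v i) a = lam i * v i a"
    using ex_orthonormal_eigenvectors[OF assms] by blast
  have "A a b = rank_one_sum p v lam a b" if "a < p" "b < p" for a b
  proof -
    have "rank_one_sum p v lam a b = (\<Sum>i<p. \<Sum>c<p. A a c * v i c * v i b)"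
      using v(2) \<open>a < p\<close> by (simp add: rank_one_sum_def mulv_def flip: sum_distrib_right)
    also have "\<dots> = (\<Sum>c<p. A a c * (\<Sum>i<p. v i c * v i b))"
      by (subst sum.swap) (simp add: sum_distrib_left mult.assoc)
    also have "\<dots> = (\<Sum>c<p. if c = b then A a c else 0)"
      using orthonormal_basis_columns[OF v(1) _ \<open>b < p\<close>] by (intro sum.cong) auto
    also have "\<dots> = A a b" using \<open>b < p\<close> by simp
    finally show ?thesis by simp
  qed
  with v(1) show ?thesis by blast
qed

section \<open>Spectral norm\<close>

lemma spec_norm_alt:
  "spec_norm p A = (SUP x\<in>{x. dot p x x = 1}. L2_set (mulv p A x) {..<p})"
  by (simp add: spec_norm_def dot_self L2_set_def mulv_def)

lemma L2_set_mulv_le_Frobenius: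
  assumes "dot p x x = 1"
  shows "(L2_set (mulv p A x) {..<p})\<^sup>2 \<le> (\<Sum>a<p. \<Sum>b<p. (A a b)\<^sup>2)"
proof -
  have "(L2_set (mulv p A x) {..<p})\<^sup>2 = (\<Sum>a<p. (mulv p A x a)\<^sup>2)"
    by (simp add: L2_set_def sum_nonneg)
  also have "\<dots> \<le> (\<Sum>a<p. \<Sum>b<p. (A a b)\<^sup>2)"
    using dot_Cauchy_Schwarz[of p "A _" x] assms
    by (intro sum_mono) (simp add: mulv_def dot_def power2_eq_square)
  finally show ?thesis .
qed

lemma spec_norm_upper:
  assumes "dot p x x = 1"
  shows "L2_set (mulv p A x) {..<p} \<le> spec_norm p A"
  unfolding spec_norm_alt
proof (rule cSUP_upper)
  show "bdd_above ((\<lambda>x. L2_set (mulv p A x) {..<p}) ` {x. dot p x x = 1})"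
    using L2_set_mulv_le_Frobenius real_le_rsqrt by (auto simp: bdd_above_def) blast
qed (use assms in simp)

lemma dot_basis_vec_self: "j < p \<Longrightarrow> dot p (basis_vec j) (basis_vec j) = 1"
  by (simp add: dot_basis_vec_left) (simp add: basis_vec_def)

lemma spec_norm_least:
  assumes "0 < p" "\<And>x. dot p x x = 1 \<Longrightarrow> L2_set (mulv p A x) {..<p} \<le> c"
  shows "spec_norm p A \<le> c"
  unfolding spec_norm_alt
  using assms dot_basis_vec_self[OF \<open>0 < p\<close>] by (intro cSUP_least) auto

lemma spec_norm_nonneg: "0 < p \<Longrightarrow> 0 \<le> spec_norm p A"
  using spec_norm_upper[OF dot_basis_vec_self] L2_set_nonneg by (rule order_trans[rotated])

lemma spec_norm_cong:
  "(\<And>a b. a < p \<Longrightarrow> b < p \<Longrightarrow> A a b = B a b) \<Longrightarrow> spec_norm p A = spec_norm p B"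
  by (simp add: spec_norm_def)

lemma spec_norm_add_le:
  assumes "0 < p"
  shows "spec_norm p (\<lambda>a b. A a b + B a b) \<le> spec_norm p A + spec_norm p B"
proof (rule spec_norm_least[OF assms])
  fix x assume x: "dot p x x = 1"
  have "mulv p (\<lambda>a b. A a b + B a b) x = (\<lambda>a. mulv p A x a + mulv p B x a)"
    by (simp add: fun_eq_iff mulv_def distrib_right sum.distrib)
  then have "L2_set (mulv p (\<lambda>a b. A a b + B a b) x) {..<p}
      \<le> L2_set (mulv p A x) {..<p} + L2_set (mulv p B x) {..<p}"
    by (simp add: L2_set_triangle_ineq)
  also have "\<dots> \<le> spec_norm p A + spec_norm p B"
    by (intro add_mono spec_norm_upper x)
  finally show "L2_set (mulv p (\<lambda>a b. A a b + B a b) x) {..<p} \<le> spec_norm p A + spec_norm p B" .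
qed

lemma spec_norm_le_Frobenius:
  assumes "0 < p"
  shows "(spec_norm p A)\<^sup>2 \<le> (\<Sum>a<p. \<Sum>b<p. (A a b)\<^sup>2)"
proof -
  have "spec_norm p A \<le> sqrt (\<Sum>a<p. \<Sum>b<p. (A a b)\<^sup>2)"
    using L2_set_mulv_le_Frobenius by (intro spec_norm_least[OF assms] real_le_rsqrt)
  then have "(spec_norm p A)\<^sup>2 \<le> (sqrt (\<Sum>a<p. \<Sum>b<p. (A a b)\<^sup>2))\<^sup>2"
    by (intro power_mono spec_norm_nonneg assms)
  then show ?thesis by (simp add: sum_nonneg)
qed

lemma weighted_Cauchy_Schwarz_sum:
  fixes w x :: "'a \<Rightarrow> real"
  shows "(\<Sum>i\<in>I. w i * x i)\<^sup>2 \<le> (\<Sum>i\<in>I. \<bar>w i\<bar>) * (\<Sum>i\<in>I. \<bar>w i\<bar> * (x i)\<^sup>2)"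
proof -
  have "\<bar>\<Sum>i\<in>I. w i * x i\<bar> \<le> (\<Sum>i\<in>I. sqrt \<bar>w i\<bar> * (sqrt \<bar>w i\<bar> * \<bar>x i\<bar>))"
    by (rule order_trans[OF sum_abs]) (simp add: abs_mult flip: mult.assoc)
  then have "(\<Sum>i\<in>I. w i * x i)\<^sup>2 \<le> (\<Sum>i\<in>I. sqrt \<bar>w i\<bar> * (sqrt \<bar>w i\<bar> * \<bar>x i\<bar>))\<^sup>2"
    by (rule power2_le_iff_abs_le[THEN iffD2, rotated]) (simp add: sum_nonneg)
  also have "\<dots> \<le> (\<Sum>i\<in>I. (sqrt \<bar>w i\<bar>)\<^sup>2) * (\<Sum>i\<in>I. (sqrt \<bar>w i\<bar> * \<bar>x i\<bar>)\<^sup>2)"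
    by (rule Cauchy_Schwarz_ineq_sum)
  finally show ?thesis by (simp add: power_mult_distrib)
qed

lemma spec_norm_Schur_test:
  assumes "0 < p"
    and row: "\<And>a. a < p \<Longrightarrow> (\<Sum>b<p. \<bar>A a b\<bar>) \<le> r"
    and col: "\<And>b. b < p \<Longrightarrow> (\<Sum>a<p. \<bar>A a b\<bar>) \<le> c"
  shows "spec_norm p A \<le> sqrt (r * c)"
proof (rule spec_norm_least[OF \<open>0 < p\<close>])
  fix x assume x: "dot p x x = 1"
  have r_nonneg: "0 \<le> r"
    using row[OF \<open>0 < p\<close>] by (rule order_trans[rotated]) (simp add: sum_nonneg)
  have "(\<Sum>a<p. (mulv p A x a)\<^sup>2) \<le> (\<Sum>a<p. r * (\<Sum>b<p. \<bar>A a b\<bar> * (x b)\<^sup>2))"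
    unfolding mulv_def using row
    by (intro sum_mono order_trans[OF weighted_Cauchy_Schwarz_sum] mult_right_mono sum_nonneg) auto
  also have "\<dots> = r * (\<Sum>b<p. (\<Sum>a<p. \<bar>A a b\<bar>) * (x b)\<^sup>2)"
    by (simp add: sum_distrib_left[symmetric] sum_distrib_right) (subst sum.swap, simp)
  also have "\<dots> \<le> r * (\<Sum>b<p. c * (x b)\<^sup>2)"
    using col r_nonneg by (intro mult_left_mono sum_mono mult_right_mono) auto
  also have "\<dots> = r * c"
    using x by (simp add: sum_distrib_left[symmetric] dot_self)
  finally show "L2_set (mulv p A x) {..<p} \<le> sqrt (r * c)"
    unfolding L2_set_def by (rule real_sqrt_le_mono)
qed

lemma spec_norm_le_column_sum:
  assumes "0 < p" "symmetric_mat p A" and col: "\<And>b. b < p \<Longrightarrow> (\<Sum>a<p. \<bar>A a b\<bar>) \<le> c"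
  shows "spec_norm p A \<le> c"
proof -
  have "(\<Sum>b<p. \<bar>A a b\<bar>) = (\<Sum>b<p. \<bar>A b a\<bar>)" if "a < p" for a
    using assms(2) that by (intro sum.cong) (auto simp: symmetric_mat_def)
  then have "spec_norm p A \<le> sqrt (c * c)"
    using col by (intro spec_norm_Schur_test[OF \<open>0 < p\<close>]) auto
  moreover have "0 \<le> c"
    using col[OF \<open>0 < p\<close>] by (rule order_trans[rotated]) (simp add: sum_nonneg)
  ultimately show ?thesis by simp
qed

lemma abs_quad_form_le_spec_norm:
  assumes "dot p x x = 1"
  shows "\<bar>quad_form p A x\<bar> \<le> spec_norm p A"
proof -
  have "(quad_form p A x)\<^sup>2 \<le> (L2_set (mulv p A x) {..<p})\<^sup>2"
    using dot_Cauchy_Schwarz[of p x "mulv p A x"] assms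
    by (simp add: quad_form_def L2_set_def sum_nonneg dot_self)
  then have "\<bar>quad_form p A x\<bar> \<le> L2_set (mulv p A x) {..<p}"
    by (simp add: abs_le_square_iff[symmetric] L2_set_nonneg)
  with spec_norm_upper[OF assms, of A] show ?thesis by linarith
qed

lemma mulv_rank_one_sum:
  "mulv p (rank_one_sum k v c) x a = (\<Sum>i<k. (c i * dot p x (v i)) * v i a)"
proof -
  have "mulv p (rank_one_sum k v c) x a = (\<Sum>b<p. \<Sum>i<k. c i * v i a * v i b * x b)"
    by (simp add: mulv_def rank_one_sum_def sum_distrib_right)
  also have "\<dots> = (\<Sum>i<k. \<Sum>b<p. c i * v i a * v i b * x b)"
    by (rule sum.swap)
  also have "\<dots> = (\<Sum>i<k. (c i * dot p x (v i)) * v i a)"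
    by (simp add: dot_def sum_distrib_left sum_distrib_right mult_ac)
  finally show ?thesis .
qed

lemma quad_form_rank_one_sum:
  "quad_form p (rank_one_sum k v c) x = (\<Sum>i<k. c i * (dot p x (v i))\<^sup>2)"
proof -
  have "quad_form p (rank_one_sum k v c) x = dot p (\<lambda>a. \<Sum>i<k. (c i * dot p x (v i)) * v i a) x"
    unfolding quad_form_def mulv_rank_one_sum[abs_def] by (rule dot_commute)
  then show ?thesis
    by (simp add: dot_sum_left dot_scale_left dot_commute[of p "v _" x] power2_eq_square mult.assoc)
qed

lemma dot_self_orthonormal_combination:
  assumes "orthonormal p k v"
  shows "dot p (\<lambda>a. \<Sum>i<k. c i * v i a) (\<lambda>a. \<Sum>i<k. c i * v i a) = (\<Sum>i<k. (c i)\<^sup>2)"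
proof -
  let ?u = "\<lambda>a. \<Sum>i<k. c i * v i a"
  have "dot p ?u ?u = (\<Sum>i<k. c i * dot p ?u (v i))"
    by (subst dot_sum_left) (simp add: dot_scale_left dot_commute[of p "v _" ?u])
  also have "\<dots> = (\<Sum>i<k. c i * c i)"
    using sum_dot_orthonormal[OF assms, of _ c]
    by (intro sum.cong) (auto simp: dot_sum_left dot_scale_left)
  finally show ?thesis by (simp add: power2_eq_square)
qed

lemma spec_norm_rank_one_sum_le:
  assumes "0 < p" "orthonormal p k v" "0 \<le> m" and coeff: "\<And>i. i < k \<Longrightarrow> \<bar>c i\<bar> \<le> m"
  shows "spec_norm p (rank_one_sum k v c) \<le> m"
proof (rule spec_norm_least[OF \<open>0 < p\<close>])
  fix x assume x: "dot p x x = 1"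
  have "(\<Sum>a<p. (mulv p (rank_one_sum k v c) x a)\<^sup>2)
      = dot p (mulv p (rank_one_sum k v c) x) (mulv p (rank_one_sum k v c) x)"
    by (rule dot_self[symmetric])
  also have "\<dots> = (\<Sum>i<k. (c i * dot p x (v i))\<^sup>2)"
    unfolding mulv_rank_one_sum[abs_def] by (rule dot_self_orthonormal_combination[OF assms(2)])
  also have "\<dots> \<le> (\<Sum>i<k. m\<^sup>2 * (dot p x (v i))\<^sup>2)"
    unfolding power_mult_distrib using coeff
    by (intro sum_mono mult_right_mono) (auto simp: power2_le_iff_abs_le \<open>0 \<le> m\<close>)
  also have "\<dots> \<le> m\<^sup>2"
    using Bessel_inequality[OF assms(2), of x] x
    by (simp add: sum_distrib_left[symmetric] mult_left_le)
  finally show "L2_set (mulv p (rank_one_sum k v c) x) {..<p} \<le> m"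
    unfolding L2_set_def using \<open>0 \<le> m\<close> by (rule real_le_lsqrt[rotated])
qed

section \<open>Positive semidefinite part\<close>

definition psd_mat :: "nat \<Rightarrow> (nat \<Rightarrow> nat \<Rightarrow> real) \<Rightarrow> bool" where
  "psd_mat p A \<longleftrightarrow> (\<forall>x. 0 \<le> quad_form p A x)"

lemma psd_part_eigendecomposition:
  assumes "symmetric_mat p A"
  obtains v lam where "orthonormal p p v"
    and "\<And>a b. a < p \<Longrightarrow> b < p \<Longrightarrow> A a b = rank_one_sum p v lam a b"
    and "\<And>a b. a < p \<Longrightarrow> b < p \<Longrightarrow> psd_part p A a b = rank_one_sum p v (\<lambda>i. max (lam i) 0) a b"
proof -
  let ?decomposition = "\<lambda>v lam M. orthonormal p p v
      \<and> (\<forall>a<p. \<forall>b<p. A a b = rank_one_sum p v lam a b)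
      \<and> M = (\<lambda>a b. if a < p \<and> b < p then rank_one_sum p v (\<lambda>i. max (lam i) 0) a b else 0)"
  have "\<exists>M v lam. ?decomposition v lam M"
    using ex_eigendecomposition[OF assms] by blast
  then have "\<exists>v lam. ?decomposition v lam (psd_part p A)"
    unfolding psd_part_def orthonormal_def dot_def rank_one_sum_def by (rule someI_ex)
  then obtain v lam where "?decomposition v lam (psd_part p A)" by blast
  then show thesis by (intro that[of v lam]) auto
qed

lemma eigenvalue_ge_neg_spec_norm:
  assumes "orthonormal p p v" "i < p" "psd_mat p B"
    and A: "\<And>a b. a < p \<Longrightarrow> b < p \<Longrightarrow> A a b = rank_one_sum p v lam a b"
  shows "- spec_norm p (\<lambda>a b. A a b - B a b) \<le> lam i"
proof -
  have "quad_form p (\<lambda>a b. A a b - B a b) (v i)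
      = quad_form p (rank_one_sum p v lam) (v i) - quad_form p B (v i)"
    using A
    by (simp add: quad_form_def dot_def mulv_def left_diff_distrib right_diff_distrib sum_subtractf)
  also have "quad_form p (rank_one_sum p v lam) (v i) = (\<Sum>j<p. lam j * dot p (v j) (v i))"
    unfolding quad_form_rank_one_sum
    using assms(1,2) by (intro sum.cong) (auto simp: orthonormal_def)
  also have "\<dots> = lam i"
    using assms(1,2) by (rule sum_dot_orthonormal)
  finally have "quad_form p (\<lambda>a b. A a b - B a b) (v i) \<le> lam i"
    using \<open>psd_mat p B\<close> by (simp add: psd_mat_def)
  moreover have "dot p (v i) (v i) = 1"
    using assms(1,2) by (simp add: orthonormal_def)
  ultimately show ?thesis
    using abs_quad_form_le_spec_norm[of p "v i" "\<lambda>a b. A a b - B a b"] by linarith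
qed

lemma spec_norm_psd_part_diff_le:
  assumes "0 < p" "symmetric_mat p A" "psd_mat p B"
  shows "spec_norm p (\<lambda>a b. psd_part p A a b - A a b) \<le> spec_norm p (\<lambda>a b. A a b - B a b)"
proof -
  obtain v lam where v: "orthonormal p p v"
    and A: "\<And>a b. a < p \<Longrightarrow> b < p \<Longrightarrow> A a b = rank_one_sum p v lam a b"
    and psd_part: "\<And>a b. a < p \<Longrightarrow> b < p \<Longrightarrow>
      psd_part p A a b = rank_one_sum p v (\<lambda>i. max (lam i) 0) a b"
    using psd_part_eigendecomposition[OF assms(2)] by blast
  have "spec_norm p (\<lambda>a b. psd_part p A a b - A a b)
      = spec_norm p (rank_one_sum p v (\<lambda>i. max (lam i) 0 - lam i))"
    by (intro spec_norm_cong)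
      (simp add: A psd_part, simp add: rank_one_sum_def sum_subtractf left_diff_distrib)
  also have "\<dots> \<le> spec_norm p (\<lambda>a b. A a b - B a b)"
  proof (rule spec_norm_rank_one_sum_le[OF \<open>0 < p\<close> v spec_norm_nonneg[OF \<open>0 < p\<close>]])
    show "\<bar>max (lam i) 0 - lam i\<bar> \<le> spec_norm p (\<lambda>a b. A a b - B a b)" if "i < p" for i
      using eigenvalue_ge_neg_spec_norm[OF v that \<open>psd_mat p B\<close> A]
        spec_norm_nonneg[OF \<open>0 < p\<close>, of "\<lambda>a b. A a b - B a b"] by (simp add: max_def)
  qed
  finally show ?thesis .
qed

lemma spec_norm_psd_part_le:
  assumes "0 < p" "symmetric_mat p A" "psd_mat p B"
  shows "spec_norm p (\<lambda>a b. psd_part p A a b - B a b) \<le> 2 * spec_norm p (\<lambda>a b. A a b - B a b)"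
proof -
  have "spec_norm p (\<lambda>a b. (psd_part p A a b - A a b) + (A a b - B a b))
      \<le> spec_norm p (\<lambda>a b. psd_part p A a b - A a b) + spec_norm p (\<lambda>a b. A a b - B a b)"
    by (rule spec_norm_add_le[OF \<open>0 < p\<close>])
  with spec_norm_psd_part_diff_le[OF assms] show ?thesis by simp
qed

section \<open>Thresholding\<close>

lemma symmetric_mat_threshold: "symmetric_mat p A \<Longrightarrow> symmetric_mat p (threshold \<tau> A)"
  by (simp add: symmetric_mat_def threshold_def)

lemma abs_threshold_diff_le:
  assumes "0 \<le> \<tau>" "\<bar>A a b - y\<bar> \<le> \<tau>"
  shows "\<bar>threshold \<tau> A a b - y\<bar> \<le> (if y = 0 then 0 else 2 * \<tau>)"
  using assms by (auto simp: threshold_def)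

lemma spec_norm_threshold_le:
  assumes "0 < p" "0 \<le> \<tau>" "in_G0 p s S" "symmetric_mat p S" "symmetric_mat p A"
    and close: "\<And>a b. a < p \<Longrightarrow> b < p \<Longrightarrow> \<bar>A a b - S a b\<bar> \<le> \<tau>"
  shows "spec_norm p (\<lambda>a b. threshold \<tau> A a b - S a b) \<le> 2 * (real s + 1) * \<tau>"
proof (rule spec_norm_le_column_sum[OF \<open>0 < p\<close>])
  show "symmetric_mat p (\<lambda>a b. threshold \<tau> A a b - S a b)"
    using assms(4) symmetric_mat_threshold[OF assms(5), of \<tau>] by (simp add: symmetric_mat_def)
  fix b assume "b < p"
  define support where "support = {a. a < p \<and> a \<noteq> b \<and> S a b \<noteq> 0}"
  have "(\<Sum>a<p. \<bar>threshold \<tau> A a b - S a b\<bar>) \<le> (\<Sum>a<p. if S a b = 0 then 0 else 2 * \<tau>)"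
    using close \<open>b < p\<close> \<open>0 \<le> \<tau>\<close> by (intro sum_mono abs_threshold_diff_le) auto
  also have "\<dots> = (\<Sum>a\<in>{a \<in> {..<p}. S a b \<noteq> 0}. 2 * \<tau>)"
    unfolding sum.inter_filter[OF finite_lessThan] by (intro sum.cong) auto
  also have "\<dots> \<le> (\<Sum>a\<in>insert b support. 2 * \<tau>)"
    using \<open>0 \<le> \<tau>\<close> by (intro sum_mono2) (auto simp: support_def)
  also have "\<dots> = (real (card support) + 1) * (2 * \<tau>)"
    by (simp add: support_def)
  also have "\<dots> \<le> (real s + 1) * (2 * \<tau>)"
    using assms(2,3) \<open>b < p\<close> by (intro mult_right_mono) (auto simp: in_G0_def support_def)
  finally show "(\<Sum>a<p. \<bar>threshold \<tau> A a b - S a b\<bar>) \<le> 2 * (real s + 1) * \<tau>"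
    by (simp only: mult_ac)
qed

text \<open>On an event of small probability, \<open>w\<close> is charged to the event and \<open>z\<^sup>4 / w\<close> to the whole
  space, so that no joint moment of \<open>z\<close> and the event is needed.\<close>

lemma power2_le_weighted_power4:
  fixes z w :: real
  assumes "0 < w"
  shows "2 * z\<^sup>2 \<le> w + z ^ 4 / w"
proof -
  have "2 * w * z\<^sup>2 \<le> w\<^sup>2 + (z\<^sup>2)\<^sup>2" by (rule sum_squares_bound)
  also have "(z\<^sup>2)\<^sup>2 = z ^ 4" by (simp flip: power_mult)
  finally show ?thesis
    using assms by (simp add: field_simps power2_eq_square)
qed

lemma spec_norm_threshold_square_le:
  assumes "0 < p" "0 < w"
    and bounded: "\<And>a b. a < p \<Longrightarrow> b < p \<Longrightarrow> \<bar>S a b\<bar> \<le> c" "\<And>a b. a < p \<Longrightarrow> b < p \<Longrightarrow> \<bar>R a b\<bar> \<le> c"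
  shows "(spec_norm p (\<lambda>a b. threshold \<tau> (\<lambda>a b. R a b + Z a b) a b - S a b))\<^sup>2
     \<le> (real p)\<^sup>2 * (8 * c\<^sup>2 + w) + (\<Sum>a<p. \<Sum>b<p. Z a b ^ 4 / w)"
proof -
  let ?E = "\<lambda>a b. threshold \<tau> (\<lambda>a b. R a b + Z a b) a b - S a b"
  have entry: "(?E a b)\<^sup>2 \<le> (8 * c\<^sup>2 + w) + Z a b ^ 4 / w" if "a < p" "b < p" for a b
  proof -
    have "\<bar>?E a b\<bar> \<le> 2 * c + \<bar>Z a b\<bar>"
      using bounded[OF that] by (auto simp: threshold_def)
    then have "(?E a b)\<^sup>2 \<le> (2 * c + \<bar>Z a b\<bar>)\<^sup>2"
      by (simp add: abs_le_square_iff[symmetric])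
    also have "\<dots> \<le> 8 * c\<^sup>2 + 2 * (Z a b)\<^sup>2"
      using sum_squares_bound[of "2 * c" "\<bar>Z a b\<bar>"] by (simp add: power2_sum power_mult_distrib)
    finally show ?thesis
      using power2_le_weighted_power4[OF \<open>0 < w\<close>, of "Z a b"] by linarith
  qed
  have "(spec_norm p ?E)\<^sup>2 \<le> (\<Sum>a<p. \<Sum>b<p. (?E a b)\<^sup>2)"
    by (rule spec_norm_le_Frobenius[OF \<open>0 < p\<close>])
  also have "\<dots> \<le> (\<Sum>a<p. \<Sum>b<p. (8 * c\<^sup>2 + w) + Z a b ^ 4 / w)"
    using entry by (intro sum_mono) auto
  also have "\<dots> = (real p)\<^sup>2 * (8 * c\<^sup>2 + w) + (\<Sum>a<p. \<Sum>b<p. Z a b ^ 4 / w)"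
    by (simp add: sum.distrib power2_eq_square algebra_simps)
  finally show ?thesis .
qed

section \<open>Products of probability spaces\<close>

lemma distr_pair_snd:
  assumes "prob_space M" "sigma_finite_measure N"
  shows "distr (M \<Otimes>\<^sub>M N) N snd = N"
proof (rule measure_eqI)
  interpret M: prob_space M by fact
  interpret N: sigma_finite_measure N by fact
  fix A assume "A \<in> sets (distr (M \<Otimes>\<^sub>M N) N snd)"
  then have "A \<in> sets N" by simp
  have "snd -` A \<inter> space (M \<Otimes>\<^sub>M N) = space M \<times> A"
    using sets.sets_into_space[OF \<open>A \<in> sets N\<close>] by (auto simp: space_pair_measure)
  with \<open>A \<in> sets N\<close> show "emeasure (distr (M \<Otimes>\<^sub>M N) N snd) A = emeasure N A"
    by (simp add: emeasure_distr N.emeasure_pair_measure_Times M.emeasure_space_1)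
qed simp

lemma nn_integral_pair_snd:
  assumes "prob_space M" "sigma_finite_measure N" "f \<in> borel_measurable N"
  shows "(\<integral>\<^sup>+\<omega>. f (snd \<omega>) \<partial>(M \<Otimes>\<^sub>M N)) = (\<integral>\<^sup>+x. f x \<partial>N)"
  using nn_integral_distr[of snd "M \<Otimes>\<^sub>M N" N f] assms(3)
  by (simp add: distr_pair_snd[OF assms(1,2)])

lemma AE_pair_fst:
  assumes "prob_space N" "AE x in M. Q x"
  shows "AE \<omega> in M \<Otimes>\<^sub>M N. Q (fst \<omega>)"
proof (rule AE_distrD[where M'=M])
  show "AE x in distr (M \<Otimes>\<^sub>M N) M fst. Q x"
    unfolding prob_space.distr_pair_fst[OF assms(1)] by (rule assms(2))
qed simp

lemma measure_distr_Collect: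
  assumes "f \<in> measurable M N" "{x \<in> space N. Q x} \<in> sets N"
  shows "measure (distr M N f) {x \<in> space N. Q x} = measure M {\<omega> \<in> space M. Q (f \<omega>)}"
  using measurable_space[OF assms(1)]
  by (subst measure_distr[OF assms]) (auto intro!: arg_cong[where f="measure _"])

lemma measure_pair_fst:
  assumes "prob_space N" "{x \<in> space M. Q x} \<in> sets M"
  shows "measure (M \<Otimes>\<^sub>M N) {\<omega> \<in> space (M \<Otimes>\<^sub>M N). Q (fst \<omega>)} = measure M {x \<in> space M. Q x}"
  using measure_distr_Collect[OF measurable_fst assms(2), of N]
  by (simp add: prob_space.distr_pair_fst[OF assms(1)])

lemma measure_pair_snd:
  assumes "prob_space M" "sigma_finite_measure N" "{x \<in> space N. Q x} \<in> sets N"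
  shows "measure (M \<Otimes>\<^sub>M N) {\<omega> \<in> space (M \<Otimes>\<^sub>M N). Q (snd \<omega>)} = measure N {x \<in> space N. Q x}"
  using measure_distr_Collect[OF measurable_snd assms(3), of M]
  by (simp add: distr_pair_snd[OF assms(1,2)])

section \<open>Gaussian noise\<close>

lemma normal_density_le_scaled:
  assumes "0 < \<sigma>" "0 \<le> t" "t \<le> \<bar>x - \<mu>\<bar>"
  shows "normal_density \<mu> \<sigma> x \<le> 2 * exp (- 3 * t\<^sup>2 / (8 * \<sigma>\<^sup>2)) * normal_density \<mu> (2 * \<sigma>) x"
proof -
  define y where "y = x - \<mu>"
  have "t\<^sup>2 \<le> y\<^sup>2" using assms by (simp add: y_def abs_le_square_iff[symmetric])
  then have "exp (- y\<^sup>2 / (2 * \<sigma>\<^sup>2)) \<le> exp (- 3 * t\<^sup>2 / (8 * \<sigma>\<^sup>2) + - y\<^sup>2 / (2 * (2 * \<sigma>)\<^sup>2))"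
    using \<open>0 < \<sigma>\<close> by (simp add: field_simps)
  also have "\<dots> = exp (- 3 * t\<^sup>2 / (8 * \<sigma>\<^sup>2)) * exp (- y\<^sup>2 / (2 * (2 * \<sigma>)\<^sup>2))"
    by (rule exp_add)
  finally have "normal_density \<mu> \<sigma> x
      \<le> 1 / sqrt (2 * pi * \<sigma>\<^sup>2) * (exp (- 3 * t\<^sup>2 / (8 * \<sigma>\<^sup>2)) * exp (- y\<^sup>2 / (2 * (2 * \<sigma>)\<^sup>2)))"
    unfolding normal_density_def y_def[symmetric] by (intro mult_left_mono) auto
  also have "1 / sqrt (2 * pi * \<sigma>\<^sup>2) = 2 * (1 / sqrt (2 * pi * (2 * \<sigma>)\<^sup>2))"
  proof -
    have "2 * pi * (2 * \<sigma>)\<^sup>2 = 2\<^sup>2 * (2 * pi * \<sigma>\<^sup>2)"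
      by (simp add: power_mult_distrib)
    then have "sqrt (2 * pi * (2 * \<sigma>)\<^sup>2) = 2 * sqrt (2 * pi * \<sigma>\<^sup>2)"
      by (simp only: real_sqrt_mult[of "2\<^sup>2"] real_sqrt_abs abs_numeral)
    then show ?thesis by simp
  qed
  finally show ?thesis
    unfolding normal_density_def y_def[symmetric] by (simp only: mult_ac)
qed

lemma normal_density_tail:
  assumes "0 < \<sigma>" "0 \<le> t"
  shows "measure (density lborel (normal_density \<mu> \<sigma>)) {x. \<bar>x - \<mu>\<bar> > t}
    \<le> 2 * exp (- 3 * t\<^sup>2 / (8 * \<sigma>\<^sup>2))"
proof -
  let ?c = "2 * exp (- 3 * t\<^sup>2 / (8 * \<sigma>\<^sup>2))"
  have "emeasure (density lborel (normal_density \<mu> \<sigma>)) {x. \<bar>x - \<mu>\<bar> > t}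
      = (\<integral>\<^sup>+x. ennreal (normal_density \<mu> \<sigma> x) * indicator {x. \<bar>x - \<mu>\<bar> > t} x \<partial>lborel)"
    by (rule emeasure_density) auto
  also have "\<dots> \<le> (\<integral>\<^sup>+x. ennreal (?c * normal_density \<mu> (2 * \<sigma>) x) \<partial>lborel)"
    using normal_density_le_scaled[OF assms]
    by (intro nn_integral_mono) (auto simp: indicator_def intro!: ennreal_leI)
  also have "\<dots> = ennreal (\<integral>x. ?c * normal_density \<mu> (2 * \<sigma>) x \<partial>lborel)"
    using assms by (intro nn_integral_eq_integral) auto
  also have "\<dots> = ennreal ?c" using assms by simp
  finally show ?thesis
    unfolding measure_def by (intro enn2real_leI) auto
qed

lemma nn_integral_normal_moment_even:
  assumes "0 < \<sigma>"
  shows "(\<integral>\<^sup>+x. ennreal ((x - \<mu>) ^ (2 * k)) \<partial>density lborel (normal_density \<mu> \<sigma>))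
    = ennreal (fact (2 * k) / ((2 / \<sigma>\<^sup>2) ^ k * fact k))"
proof -
  have "(\<integral>\<^sup>+x. ennreal ((x - \<mu>) ^ (2 * k)) \<partial>density lborel (normal_density \<mu> \<sigma>))
      = (\<integral>\<^sup>+x. ennreal (normal_density \<mu> \<sigma> x * (x - \<mu>) ^ (2 * k)) \<partial>lborel)"
    by (subst nn_integral_density) (auto simp: ennreal_mult')
  also have "\<dots> = ennreal (fact (2 * k) / ((2 / \<sigma>\<^sup>2) ^ k * fact k))"
    using normal_moment_even[OF assms, of \<mu> k]
    by (subst nn_integral_eq_integral)
      (auto simp: has_bochner_integral_iff intro!: AE_I2 mult_nonneg_nonneg zero_le_even_power)
  finally show ?thesis .
qed

lemma prob_space_noise_space: "0 < \<sigma> \<Longrightarrow> prob_space (noise_space p \<sigma>)"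
  unfolding noise_space_def by (intro prob_space_PiM prob_space_normal_density)

lemma sym_noise_eq_component:
  assumes "a < p" "b < p"
  obtains i where "i \<in> upper_idx p" "\<And>z. sym_noise z a b = z i"
  using assms that[of "(min a b, max a b)"]
  by (auto simp: upper_idx_def sym_noise_def min_def max_def)

lemma measurable_sym_noise:
  assumes "a < p" "b < p"
  shows "(\<lambda>z. sym_noise z a b) \<in> borel_measurable (noise_space p \<sigma>)"
proof -
  obtain i where component: "i \<in> upper_idx p" "\<And>z. sym_noise z a b = z i"
    using sym_noise_eq_component[OF assms] by blast
  have "(\<lambda>z. z i) \<in> measurable (noise_space p \<sigma>) (density lborel (normal_density 0 \<sigma>))"
    unfolding noise_space_def using component(1) by (rule measurable_component_singleton)
  then show ?thesis
    unfolding component(2) by (simp cong: measurable_cong_sets)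
qed

lemma distr_sym_noise:
  assumes "a < p" "b < p" "0 < \<sigma>"
  shows "distr (noise_space p \<sigma>) borel (\<lambda>z. sym_noise z a b) = density lborel (normal_density 0 \<sigma>)"
proof -
  let ?N = "density lborel (normal_density 0 \<sigma>)"
  obtain i where component: "i \<in> upper_idx p" "\<And>z. sym_noise z a b = z i"
    using sym_noise_eq_component[OF assms(1,2)] by blast
  have "distr (noise_space p \<sigma>) borel (\<lambda>z. sym_noise z a b) = distr (noise_space p \<sigma>) ?N (\<lambda>z. z i)"
    by (intro distr_cong) (simp_all add: component(2))
  also have "\<dots> = ?N"
    unfolding noise_space_def using component(1) \<open>0 < \<sigma>\<close>
    by (intro distr_PiM_component[where M="\<lambda>_. ?N"]) (auto intro: prob_space_normal_density)
  finally show ?thesis .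
qed

lemma sym_noise_tail:
  assumes "a < p" "b < p" "0 < \<sigma>" "0 \<le> t"
  shows "measure (noise_space p \<sigma>) {z \<in> space (noise_space p \<sigma>). \<bar>sym_noise z a b\<bar> > t}
     \<le> 2 * exp (- 3 * t\<^sup>2 / (8 * \<sigma>\<^sup>2))"
  using measure_distr_Collect[OF measurable_sym_noise[OF assms(1,2)], of "\<lambda>x. \<bar>x\<bar> > t" \<sigma>]
    normal_density_tail[OF assms(3,4), of 0]
  by (simp add: distr_sym_noise[OF assms(1-3)])

lemma nn_integral_sym_noise_power4:
  assumes "a < p" "b < p" "0 < \<sigma>"
  shows "(\<integral>\<^sup>+z. ennreal (sym_noise z a b ^ 4) \<partial>noise_space p \<sigma>) = ennreal (3 * \<sigma> ^ 4)"
proof -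
  have "(\<integral>\<^sup>+z. ennreal (sym_noise z a b ^ 4) \<partial>noise_space p \<sigma>)
      = (\<integral>\<^sup>+x. ennreal (x ^ 4) \<partial>distr (noise_space p \<sigma>) borel (\<lambda>z. sym_noise z a b))"
    by (rule nn_integral_distr[symmetric]) (auto intro: measurable_sym_noise assms)
  also have "\<dots> = ennreal (fact 4 / ((2 / \<sigma>\<^sup>2)\<^sup>2 * fact 2))"
    using nn_integral_normal_moment_even[OF \<open>0 < \<sigma>\<close>, of 0 2]
    by (simp add: distr_sym_noise[OF assms])
  also have "\<dots> = ennreal (3 * \<sigma> ^ 4)"
    by (simp add: fact_numeral power_divide)
  finally show ?thesis .
qed

section \<open>Covariance of bounded vectors\<close>

lemma abs_mult_le_1_of_norm_le_1:
  fixes x :: "nat \<Rightarrow> real"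
  assumes "(\<Sum>i<p. (x i)\<^sup>2) \<le> 1" "a < p" "b < p"
  shows "\<bar>x a * x b\<bar> \<le> 1"
  using abs_coordinate_le_1[OF assms(1,2)] abs_coordinate_le_1[OF assms(1,3)]
  by (simp add: abs_mult mult_le_one)

lemma abs_sample_cov_le_1:
  assumes "\<And>k. k < n \<Longrightarrow> (\<Sum>i<p. (X k i)\<^sup>2) \<le> 1" "a < p" "b < p"
  shows "\<bar>sample_cov n X a b\<bar> \<le> 1"
proof -
  have "\<bar>\<Sum>k<n. X k a * X k b\<bar> \<le> (\<Sum>k<n. \<bar>X k a * X k b\<bar>)" by (rule sum_abs)
  also have "\<dots> \<le> (\<Sum>k<n. 1)"
    using assms by (intro sum_mono abs_mult_le_1_of_norm_le_1) auto
  finally show ?thesis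
    by (cases "n = 0") (simp_all add: sample_cov_def field_simps)
qed

lemma symmetric_mat_cov_mat: "symmetric_mat p (cov_mat D)"
  by (simp add: symmetric_mat_def cov_mat_def mult.commute)

locale bounded_vector = prob_space D for D :: "(nat \<Rightarrow> real) measure" +
  fixes p :: nat
  assumes sets_D: "sets D = sets (PiM {..<p} (\<lambda>_. borel))"
    and norm_le_1: "AE x in D. (\<Sum>i<p. (x i)\<^sup>2) \<le> 1"
begin

lemma measurable_coordinate: "a < p \<Longrightarrow> (\<lambda>x. x a) \<in> borel_measurable D"
  by (subst measurable_cong_sets[OF sets_D refl]) (rule measurable_component_singleton, simp)

lemma AE_product_le_1: "a < p \<Longrightarrow> b < p \<Longrightarrow> AE x in D. \<bar>x a * x b\<bar> \<le> 1"
  using norm_le_1 by eventually_elim (rule abs_mult_le_1_of_norm_le_1)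

lemma integrable_product:
  assumes "a < p" "b < p"
  shows "integrable D (\<lambda>x. x a * x b)"
  using AE_product_le_1[OF assms] measurable_coordinate assms
  by (intro integrable_const_bound[where B=1]) auto

lemma abs_cov_mat_le_1:
  assumes "a < p" "b < p"
  shows "\<bar>cov_mat D a b\<bar> \<le> 1"
proof -
  have "\<bar>cov_mat D a b\<bar> \<le> (\<integral>x. \<bar>x a * x b\<bar> \<partial>D)"
    unfolding cov_mat_def by (rule integral_abs_bound)
  also have "\<dots> \<le> (\<integral>x. 1 \<partial>D)"
    using AE_product_le_1[OF assms] integrable_product[OF assms] by (intro integral_mono_AE) auto
  finally show ?thesis by (simp add: prob_space)
qed

lemma psd_mat_cov_mat: "psd_mat p (cov_mat D)"
  unfolding psd_mat_def
proof
  fix v :: "nat \<Rightarrow> real"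
  have "(\<Sum>a<p. v a * x a)\<^sup>2 = (\<Sum>a<p. \<Sum>b<p. v a * v b * (x a * x b))" for x
    by (simp add: power2_eq_square sum_product mult_ac)
  moreover have "0 \<le> (\<integral>x. (\<Sum>a<p. v a * x a)\<^sup>2 \<partial>D)" by simp
  ultimately have "0 \<le> (\<integral>x. (\<Sum>a<p. \<Sum>b<p. v a * v b * (x a * x b)) \<partial>D)" by simp
  also have "\<dots> = (\<Sum>a<p. \<integral>x. (\<Sum>b<p. v a * v b * (x a * x b)) \<partial>D)"
    using integrable_product
    by (intro Bochner_Integration.integral_sum Bochner_Integration.integrable_sum
        integrable_mult_right) auto
  also have "\<dots> = (\<Sum>a<p. \<Sum>b<p. \<integral>x. v a * v b * (x a * x b) \<partial>D)"
    using integrable_product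
    by (intro sum.cong refl Bochner_Integration.integral_sum integrable_mult_right) auto
  also have "\<dots> = (\<Sum>a<p. \<Sum>b<p. v a * v b * cov_mat D a b)"
    by (simp add: cov_mat_def)
  also have "\<dots> = quad_form p (cov_mat D) v"
    by (simp add: quad_form_def dot_def mulv_def sum_distrib_left mult_ac)
  finally show "0 \<le> quad_form p (cov_mat D) v" .
qed

lemma prob_space_sample_space: "prob_space (sample_space D n)"
  unfolding sample_space_def by (intro prob_space_PiM prob_space_axioms)

lemma measurable_sample_cov:
  assumes "a < p" "b < p"
  shows "(\<lambda>X. sample_cov n X a b) \<in> borel_measurable (sample_space D n)"
proof -
  have "(\<lambda>X. X k c) \<in> borel_measurable (sample_space D n)" if "k < n" "c < p" for k c
    unfolding sample_space_def using that
    by (intro measurable_compose[where f="\<lambda>X. X k" and g="\<lambda>x. x c" and N=D]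
        measurable_coordinate measurable_component_singleton) auto
  then show ?thesis unfolding sample_cov_def using assms by simp
qed

lemma AE_abs_sample_cov_le_1:
  "AE X in sample_space D n. \<forall>a<p. \<forall>b<p. \<bar>sample_cov n X a b\<bar> \<le> 1"
proof -
  have "AE X in sample_space D n. \<forall>k\<in>{..<n}. (\<Sum>i<p. (X k i)\<^sup>2) \<le> 1"
    unfolding sample_space_def
    by (intro AE_finite_allI AE_PiM_component[where M="\<lambda>_. D"])
      (auto intro: prob_space_axioms norm_le_1)
  then show ?thesis
    by eventually_elim (auto intro: abs_sample_cov_le_1)
qed

end

section \<open>Expected error\<close>

lemma symmetric_mat_dp_tilde: "symmetric_mat p (dp_tilde n X z)"
  by (auto simp: symmetric_mat_def dp_tilde_def sample_cov_def sym_noise_def mult.commute)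

lemma symmetric_mat_dp_hat: "symmetric_mat p (dp_hat \<gamma> n p \<epsilon> \<delta> X z)"
  unfolding dp_hat_def by (intro symmetric_mat_threshold symmetric_mat_dp_tilde)

lemma one_fifth_le_ln_ratio:
  assumes "0 < (\<delta>::real)" "\<delta> \<le> 1"
  shows "1 / 5 \<le> ln (1.25 / \<delta>)"
proof -
  have "1 / 5 \<le> 1 - 1 / (1.25 / \<delta>)" using assms by (simp add: field_simps)
  also have "\<dots> \<le> ln (1.25 / \<delta>)"
    using ln_le_minus_one[of "1 / (1.25 / \<delta>)"] ln_inverse[of "1.25 / \<delta>"] assms
    by (simp add: inverse_eq_divide)
  finally show ?thesis .
qed

definition dp_rate :: "nat \<Rightarrow> nat \<Rightarrow> real \<Rightarrow> real \<Rightarrow> real" where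
  "dp_rate n p \<epsilon> \<delta> = ln (real p) * ln (1.25 / \<delta>) / (real n * \<epsilon>\<^sup>2)"

definition dp_error_const :: "real \<Rightarrow> real \<Rightarrow> real" where
  "dp_error_const \<gamma> C1 = 160 * \<gamma>\<^sup>2 + 84 * C1 + 1204"

type_synonym dp_outcome = "(nat \<Rightarrow> nat \<Rightarrow> real) \<times> (nat \<times> nat \<Rightarrow> real)"

locale dp_thresholding = bounded_vector D p for D p +
  fixes n s :: nat and \<epsilon> \<delta> \<gamma> C1 :: real
  assumes n_ge_1: "1 \<le> n" and p_ge_2: "2 \<le> p" and n_le_p: "n \<le> p" and s_ge_1: "1 \<le> s"
    and epsilon: "0 < \<epsilon>" "\<epsilon> \<le> 1" and delta: "0 < \<delta>" "\<delta> \<le> 1"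
    and gamma_pos: "0 < \<gamma>" and C1_pos: "0 < C1"
    and sparse: "in_G0 p s (cov_mat D)"
    and sample_cov_tail: "\<And>a b. a < p \<Longrightarrow> b < p \<Longrightarrow>
      measure (sample_space D n) {X \<in> space (sample_space D n).
          \<bar>sample_cov n X a b - cov_mat D a b\<bar> > \<gamma> * sqrt (ln (real p) / real n)}
        \<le> C1 * real p powr (-8)"
begin

abbreviation rate :: real where "rate \<equiv> dp_rate n p \<epsilon> \<delta>"
abbreviation \<sigma>\<^sub>1 :: real where "\<sigma>\<^sub>1 \<equiv> dp_sigma1 n \<epsilon> \<delta>"
abbreviation \<tau> :: real where "\<tau> \<equiv> dp_tau \<gamma> n p \<epsilon> \<delta>"

lemma p_pos: "0 < p"
  using p_ge_2 by simp

lemma one_half_le_ln_p: "1 / 2 \<le> ln (real p)"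
proof -
  have "1 / 2 \<le> ln (2::real)" using ln2_ge_two_thirds by linarith
  also have "\<dots> \<le> ln (real p)" using p_ge_2 by simp
  finally show ?thesis .
qed

lemma rate_nonneg: "0 \<le> rate"
  using one_half_le_ln_p one_fifth_le_ln_ratio[OF delta] by (simp add: dp_rate_def)

lemma ln_p_div_n_le_rate: "ln (real p) / real n \<le> 5 * rate"
proof -
  have "\<epsilon>\<^sup>2 \<le> 5 * ln (1.25 / \<delta>)"
    using power_le_one[of \<epsilon> 2] epsilon one_fifth_le_ln_ratio[OF delta] by simp
  then have "ln (real p) / real n * \<epsilon>\<^sup>2 \<le> ln (real p) / real n * (5 * ln (1.25 / \<delta>))"
    using one_half_le_ln_p by (intro mult_left_mono) auto
  then show ?thesis
    using epsilon n_ge_1 by (simp add: dp_rate_def field_simps)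
qed

lemma inverse_p_square_le_rate: "1 / (real p)\<^sup>2 \<le> 10 * rate"
proof -
  have "real n \<le> (real p)\<^sup>2"
    using n_le_p p_ge_2 self_le_power[of "real p" 2] by simp
  then have "1 / (real p)\<^sup>2 \<le> 1 / real n"
    using n_ge_1 p_ge_2 by (intro divide_left_mono) auto
  also have "\<dots> \<le> 2 * (ln (real p) / real n)"
    using one_half_le_ln_p n_ge_1 by (simp add: field_simps)
  finally show ?thesis using ln_p_div_n_le_rate by linarith
qed

lemma sigma1_square: "\<sigma>\<^sub>1\<^sup>2 = 2 * ln (1.25 / \<delta>) / ((real n)\<^sup>2 * \<epsilon>\<^sup>2)"
  using one_fifth_le_ln_ratio[OF delta] by (simp add: dp_sigma1_def power_divide power_mult_distrib)

lemma sigma1_pos: "0 < \<sigma>\<^sub>1"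
  using one_fifth_le_ln_ratio[OF delta] n_ge_1 epsilon by (simp add: dp_sigma1_def)

lemma sigma1_square_mult_ln_p_le_rate: "\<sigma>\<^sub>1\<^sup>2 * ln (real p) \<le> 2 * rate"
proof -
  have "2 * ln (1.25 / \<delta>) * ln (real p) / ((real n)\<^sup>2 * \<epsilon>\<^sup>2)
      \<le> 2 * ln (1.25 / \<delta>) * ln (real p) / (real n * \<epsilon>\<^sup>2)"
    using one_fifth_le_ln_ratio[OF delta] one_half_le_ln_p n_ge_1 epsilon
    by (intro divide_left_mono mult_right_mono) (auto simp: power2_eq_square)
  then show ?thesis by (simp add: sigma1_square dp_rate_def mult_ac)
qed

lemma sigma1_square_le_rate: "\<sigma>\<^sub>1\<^sup>2 \<le> 4 * rate"
proof -
  have "\<sigma>\<^sub>1\<^sup>2 * 1 \<le> \<sigma>\<^sub>1\<^sup>2 * (2 * ln (real p))"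
    using one_half_le_ln_p by (intro mult_left_mono) auto
  with sigma1_square_mult_ln_p_le_rate show ?thesis by linarith
qed

definition sample_radius :: real where
  "sample_radius = \<gamma> * sqrt (ln (real p) / real n)"

definition noise_radius :: real where
  "noise_radius = 4 * \<sigma>\<^sub>1 * sqrt (ln (real p))"

lemma tau_eq: "\<tau> = sample_radius + noise_radius"
  by (simp add: dp_tau_def sample_radius_def noise_radius_def dp_sigma1_def)

lemma noise_radius_nonneg: "0 \<le> noise_radius"
  using sigma1_pos p_ge_2 by (simp add: noise_radius_def)

lemma tau_nonneg: "0 \<le> \<tau>"
  using gamma_pos p_ge_2 noise_radius_nonneg by (simp add: tau_eq sample_radius_def)

lemma tau_square_le_rate: "\<tau>\<^sup>2 \<le> (10 * \<gamma>\<^sup>2 + 64) * rate"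
proof -
  have "\<tau>\<^sup>2 \<le> 2 * sample_radius\<^sup>2 + 2 * noise_radius\<^sup>2"
    using sum_squares_bound[of sample_radius noise_radius] by (simp add: tau_eq power2_sum)
  also have "sample_radius\<^sup>2 = \<gamma>\<^sup>2 * (ln (real p) / real n)"
    using one_half_le_ln_p by (simp add: sample_radius_def power_mult_distrib)
  also have "noise_radius\<^sup>2 = 16 * (\<sigma>\<^sub>1\<^sup>2 * ln (real p))"
    using one_half_le_ln_p by (simp add: noise_radius_def power_mult_distrib)
  also have "2 * (\<gamma>\<^sup>2 * (ln (real p) / real n)) + 2 * (16 * (\<sigma>\<^sub>1\<^sup>2 * ln (real p)))
      \<le> 2 * (\<gamma>\<^sup>2 * (5 * rate)) + 2 * (16 * (2 * rate))"
    using ln_p_div_n_le_rate sigma1_square_mult_ln_p_le_rate by (intro add_mono mult_left_mono) auto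
  finally show ?thesis by (simp add: algebra_simps)
qed

abbreviation joint_space :: "dp_outcome measure" where
  "joint_space \<equiv> sample_space D n \<Otimes>\<^sub>M noise_space p \<sigma>\<^sub>1"

sublocale samples: prob_space "sample_space D n"
  by (rule prob_space_sample_space)

sublocale noise: prob_space "noise_space p \<sigma>\<^sub>1"
  by (rule prob_space_noise_space[OF sigma1_pos])

sublocale joint: pair_prob_space "sample_space D n" "noise_space p \<sigma>\<^sub>1" ..

definition sample_deviation :: "nat \<Rightarrow> nat \<Rightarrow> dp_outcome set" where
  "sample_deviation a b =
     {\<omega> \<in> space joint_space. \<bar>sample_cov n (fst \<omega>) a b - cov_mat D a b\<bar> > sample_radius}"

definition noise_deviation :: "nat \<Rightarrow> nat \<Rightarrow> dp_outcome set" where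
  "noise_deviation a b = {\<omega> \<in> space joint_space. \<bar>sym_noise (snd \<omega>) a b\<bar> > noise_radius}"

definition bad_event :: "dp_outcome set" where
  "bad_event = (\<Union>(a, b)\<in>{..<p} \<times> {..<p}. sample_deviation a b \<union> noise_deviation a b)"

lemma measurable_sample_cov_fst [measurable]:
  "a < p \<Longrightarrow> b < p \<Longrightarrow> (\<lambda>\<omega>. sample_cov n (fst \<omega>) a b) \<in> borel_measurable joint_space"
  by (rule measurable_compose[OF measurable_fst measurable_sample_cov])

lemma measurable_sym_noise_snd [measurable]:
  "a < p \<Longrightarrow> b < p \<Longrightarrow> (\<lambda>\<omega>. sym_noise (snd \<omega>) a b) \<in> borel_measurable joint_space"
  by (rule measurable_compose[OF measurable_snd measurable_sym_noise])

lemma sets_deviation: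
  assumes "a < p" "b < p"
  shows sets_sample_deviation: "sample_deviation a b \<in> sets joint_space"
    and sets_noise_deviation: "noise_deviation a b \<in> sets joint_space"
  unfolding sample_deviation_def noise_deviation_def using assms by measurable

lemma sets_bad_event: "bad_event \<in> sets joint_space"
  unfolding bad_event_def using sets_deviation by (intro sets.finite_UN) auto

lemma prob_sample_deviation_le:
  assumes "a < p" "b < p"
  shows "measure joint_space (sample_deviation a b) \<le> C1 / real p ^ 8"
proof -
  have "{X \<in> space (sample_space D n). \<bar>sample_cov n X a b - cov_mat D a b\<bar> > sample_radius}
      \<in> sets (sample_space D n)"
    using measurable_sample_cov[OF assms, of n] by measurable
  then have "measure joint_space (sample_deviation a b) \<le> C1 * real p powr (-8)"
    using sample_cov_tail[OF assms]
    unfolding sample_deviation_def sample_radius_def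
    by (subst measure_pair_fst[OF noise.prob_space_axioms])
  then show ?thesis
    using p_pos by (simp add: powr_minus_divide)
qed

lemma prob_noise_deviation_le:
  assumes "a < p" "b < p"
  shows "measure joint_space (noise_deviation a b) \<le> 2 / real p ^ 6"
proof -
  have "{z \<in> space (noise_space p \<sigma>\<^sub>1). \<bar>sym_noise z a b\<bar> > noise_radius}
      \<in> sets (noise_space p \<sigma>\<^sub>1)"
    using measurable_sym_noise[OF assms] by measurable
  then have "measure joint_space (noise_deviation a b)
      = measure (noise_space p \<sigma>\<^sub>1)
          {z \<in> space (noise_space p \<sigma>\<^sub>1). \<bar>sym_noise z a b\<bar> > noise_radius}"
    unfolding noise_deviation_def
    by (intro measure_pair_snd samples.prob_space_axioms noise.sigma_finite_measure_axioms)
  also have "\<dots> \<le> 2 * exp (- 3 * noise_radius\<^sup>2 / (8 * \<sigma>\<^sub>1\<^sup>2))"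
    by (intro sym_noise_tail assms sigma1_pos noise_radius_nonneg)
  also have "- 3 * noise_radius\<^sup>2 / (8 * \<sigma>\<^sub>1\<^sup>2) = - (6 * ln (real p))"
    using sigma1_pos p_pos by (simp add: noise_radius_def power_mult_distrib)
  also have "exp (- (6 * ln (real p))) = 1 / real p ^ 6"
    using p_pos by (simp add: exp_minus exp_of_nat_mult[of 6, simplified] inverse_eq_divide)
  finally show ?thesis by simp
qed

lemma prob_bad_event_le: "measure joint_space bad_event \<le> (C1 + 2) / real p ^ 4"
proof -
  have deviation:
    "measure joint_space (sample_deviation a b \<union> noise_deviation a b) \<le> (C1 + 2) / real p ^ 6"
    if "a < p" "b < p" for a b
  proof -
    have "measure joint_space (sample_deviation a b \<union> noise_deviation a b)
        \<le> measure joint_space (sample_deviation a b) + measure joint_space (noise_deviation a b)"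
      by (intro measure_Un_le sets_deviation that)
    also have "\<dots> \<le> C1 / real p ^ 8 + 2 / real p ^ 6"
      by (intro add_mono prob_sample_deviation_le prob_noise_deviation_le that)
    also have "C1 / real p ^ 8 \<le> C1 / real p ^ 6"
      using p_ge_2 C1_pos by (intro divide_left_mono power_increasing) auto
    finally show ?thesis by (simp add: add_divide_distrib)
  qed
  have "measure joint_space bad_event
      \<le> (\<Sum>(a, b)\<in>{..<p} \<times> {..<p}. measure joint_space (sample_deviation a b \<union> noise_deviation a b))"
    unfolding bad_event_def case_prod_unfold
    using sets_deviation by (intro joint.finite_measure_subadditive_finite) auto
  also have "\<dots> \<le> real (card ({..<p} \<times> {..<p})) * ((C1 + 2) / real p ^ 6)"
    using deviation by (intro sum_bounded_above) auto
  also have "\<dots> = (C1 + 2) / real p ^ 4"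
    using p_pos by (simp add: field_simps eval_nat_numeral)
  finally show ?thesis .
qed

text \<open>With this weight \<open>w\<close>, both \<open>p\<^sup>2 w\<close> times the probability of \<open>bad_event\<close> and \<open>1 / w\<close> times the
  sum of the fourth moments of the noise are of order \<open>\<sigma>\<^sub>1\<^sup>2\<close>.\<close>

definition noise_weight :: real where
  "noise_weight = \<sigma>\<^sub>1\<^sup>2 * (real p)\<^sup>2"

lemma noise_weight_pos: "0 < noise_weight"
  using sigma1_pos p_pos by (simp add: noise_weight_def)

definition noise_energy :: "dp_outcome \<Rightarrow> real" where
  "noise_energy \<omega> = (\<Sum>a<p. \<Sum>b<p. sym_noise (snd \<omega>) a b ^ 4 / noise_weight)"

lemma noise_energy_nonneg: "0 \<le> noise_energy \<omega>"
  unfolding noise_energy_def using noise_weight_pos by (intro sum_nonneg divide_nonneg_pos) auto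

lemma measurable_noise_energy [measurable]: "noise_energy \<in> borel_measurable joint_space"
  unfolding noise_energy_def by measurable

abbreviation hat_error :: "dp_outcome \<Rightarrow> real" where
  "hat_error \<omega> \<equiv> spec_norm p (\<lambda>a b. dp_hat \<gamma> n p \<epsilon> \<delta> (fst \<omega>) (snd \<omega>) a b - cov_mat D a b)"

abbreviation plus_error :: "dp_outcome \<Rightarrow> real" where
  "plus_error \<omega> \<equiv> spec_norm p (\<lambda>a b. dp_plus \<gamma> n p \<epsilon> \<delta> (fst \<omega>) (snd \<omega>) a b - cov_mat D a b)"

lemma hat_error_square_le_of_not_bad_event:
  assumes "\<omega> \<in> space joint_space" "\<omega> \<notin> bad_event"
  shows "(hat_error \<omega>)\<^sup>2 \<le> 16 * (real s)\<^sup>2 * \<tau>\<^sup>2"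
proof -
  have "\<bar>dp_tilde n (fst \<omega>) (snd \<omega>) a b - cov_mat D a b\<bar> \<le> \<tau>" if "a < p" "b < p" for a b
  proof -
    have "\<omega> \<notin> sample_deviation a b" "\<omega> \<notin> noise_deviation a b"
      using assms(2) that by (auto simp: bad_event_def)
    then show ?thesis
      using assms(1) unfolding sample_deviation_def noise_deviation_def dp_tilde_def tau_eq by simp
  qed
  then have "hat_error \<omega> \<le> 2 * (real s + 1) * \<tau>"
    unfolding dp_hat_def using p_pos tau_nonneg sparse
    by (intro spec_norm_threshold_le symmetric_mat_cov_mat symmetric_mat_dp_tilde)
  also have "\<dots> \<le> 4 * real s * \<tau>"
    using s_ge_1 tau_nonneg by (intro mult_right_mono) auto
  finally have "(hat_error \<omega>)\<^sup>2 \<le> (4 * real s * \<tau>)\<^sup>2"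
    by (intro power_mono spec_norm_nonneg p_pos)
  then show ?thesis by (simp add: power_mult_distrib)
qed

lemma hat_error_square_le:
  assumes "\<And>a b. a < p \<Longrightarrow> b < p \<Longrightarrow> \<bar>sample_cov n (fst \<omega>) a b\<bar> \<le> 1"
  shows "(hat_error \<omega>)\<^sup>2 \<le> (real p)\<^sup>2 * (8 + noise_weight) + noise_energy \<omega>"
  using spec_norm_threshold_square_le[OF p_pos noise_weight_pos abs_cov_mat_le_1 assms]
  by (simp add: dp_hat_def dp_tilde_def[abs_def] noise_energy_def)

definition error_bound :: "dp_outcome \<Rightarrow> real" where
  "error_bound \<omega> = 16 * (real s)\<^sup>2 * \<tau>\<^sup>2 + (real p)\<^sup>2 * (8 + noise_weight) * indicator bad_event \<omega>
     + noise_energy \<omega>"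

lemma hat_error_square_le_error_bound:
  assumes "\<omega> \<in> space joint_space"
    and "\<And>a b. a < p \<Longrightarrow> b < p \<Longrightarrow> \<bar>sample_cov n (fst \<omega>) a b\<bar> \<le> 1"
  shows "(hat_error \<omega>)\<^sup>2 \<le> error_bound \<omega>"
proof (cases "\<omega> \<in> bad_event")
  case True
  have "(hat_error \<omega>)\<^sup>2 \<le> (real p)\<^sup>2 * (8 + noise_weight) + noise_energy \<omega>"
    by (intro hat_error_square_le assms(2))
  also have "\<dots> \<le> error_bound \<omega>"
    using True by (simp add: error_bound_def)
  finally show ?thesis .
next
  case False
  then show ?thesis
    using hat_error_square_le_of_not_bad_event[OF assms(1)] noise_energy_nonneg[of \<omega>]
    by (simp add: error_bound_def)
qed

lemma nn_integral_noise_entry_power4: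
  assumes "a < p" "b < p"
  shows "(\<integral>\<^sup>+\<omega>. ennreal (sym_noise (snd \<omega>) a b ^ 4) \<partial>joint_space) = ennreal (3 * \<sigma>\<^sub>1 ^ 4)"
proof -
  have "(\<integral>\<^sup>+\<omega>. ennreal (sym_noise (snd \<omega>) a b ^ 4) \<partial>joint_space)
      = (\<integral>\<^sup>+z. ennreal (sym_noise z a b ^ 4) \<partial>noise_space p \<sigma>\<^sub>1)"
    using measurable_sym_noise[OF assms]
    by (intro nn_integral_pair_snd samples.prob_space_axioms noise.sigma_finite_measure_axioms)
      measurable
  also have "\<dots> = ennreal (3 * \<sigma>\<^sub>1 ^ 4)"
    by (rule nn_integral_sym_noise_power4[OF assms sigma1_pos])
  finally show ?thesis .
qed

lemma nn_integral_noise_energy: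
  "(\<integral>\<^sup>+\<omega>. ennreal (noise_energy \<omega>) \<partial>joint_space) = ennreal (3 * \<sigma>\<^sub>1\<^sup>2)"
proof -
  have "(\<integral>\<^sup>+\<omega>. ennreal (noise_energy \<omega>) \<partial>joint_space)
      = (\<integral>\<^sup>+\<omega>. (\<Sum>a<p. \<Sum>b<p. ennreal (sym_noise (snd \<omega>) a b ^ 4) / ennreal noise_weight)
          \<partial>joint_space)"
    using noise_weight_pos
    by (simp add: noise_energy_def divide_ennreal sum_nonneg flip: sum_ennreal)
  also have "\<dots> = (\<Sum>a<p. \<integral>\<^sup>+\<omega>. (\<Sum>b<p. ennreal (sym_noise (snd \<omega>) a b ^ 4) / ennreal noise_weight)
          \<partial>joint_space)"
    by (intro nn_integral_sum) measurable
  also have "\<dots> = (\<Sum>a<p. \<Sum>b<p. \<integral>\<^sup>+\<omega>. ennreal (sym_noise (snd \<omega>) a b ^ 4) / ennreal noise_weight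
          \<partial>joint_space)"
    by (intro sum.cong refl nn_integral_sum) measurable
  also have "\<dots> = (\<Sum>a<p. \<Sum>b<p. ennreal (3 * \<sigma>\<^sub>1 ^ 4) / ennreal noise_weight)"
    using nn_integral_noise_entry_power4 by (intro sum.cong refl) (simp add: nn_integral_divide)
  also have "\<dots> = ennreal (\<Sum>a<p. \<Sum>b<p. 3 * \<sigma>\<^sub>1 ^ 4 / noise_weight)"
    using noise_weight_pos by (simp add: divide_ennreal sum_ennreal sum_nonneg del: sum_constant)
  also have "(\<Sum>a<p. \<Sum>b<p. 3 * \<sigma>\<^sub>1 ^ 4 / noise_weight) = 3 * \<sigma>\<^sub>1\<^sup>2"
    using p_pos sigma1_pos by (simp add: noise_weight_def field_simps eval_nat_numeral)
  finally show ?thesis .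
qed

lemma measurable_error_bound [measurable]: "error_bound \<in> borel_measurable joint_space"
  unfolding error_bound_def using sets_bad_event by measurable

lemma nn_integral_error_bound:
  "(\<integral>\<^sup>+\<omega>. ennreal (error_bound \<omega>) \<partial>joint_space) = ennreal (16 * (real s)\<^sup>2 * \<tau>\<^sup>2
     + (real p)\<^sup>2 * (8 + noise_weight) * measure joint_space bad_event + 3 * \<sigma>\<^sub>1\<^sup>2)"
proof -
  define G where "G = 16 * (real s)\<^sup>2 * \<tau>\<^sup>2"
  define B where "B = (real p)\<^sup>2 * (8 + noise_weight)"
  have nonneg: "0 \<le> G" "0 \<le> B"
    using noise_weight_pos by (simp_all add: G_def B_def)
  have "ennreal (error_bound \<omega>)
      = ennreal G + ennreal B * indicator bad_event \<omega> + ennreal (noise_energy \<omega>)" for \<omega>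
    unfolding error_bound_def G_def[symmetric] B_def[symmetric]
    using nonneg noise_energy_nonneg[of \<omega>] by (auto simp: ennreal_plus split: split_indicator)
  then have "(\<integral>\<^sup>+\<omega>. ennreal (error_bound \<omega>) \<partial>joint_space)
      = (\<integral>\<^sup>+\<omega>. ennreal G + ennreal B * indicator bad_event \<omega> + ennreal (noise_energy \<omega>)
          \<partial>joint_space)"
    by simp
  also have "\<dots> = ennreal G + ennreal B * emeasure joint_space bad_event
      + (\<integral>\<^sup>+\<omega>. ennreal (noise_energy \<omega>) \<partial>joint_space)"
    using sets_bad_event
    by (simp add: nn_integral_add nn_integral_cmult_indicator joint.emeasure_space_1)
  also have "(\<integral>\<^sup>+\<omega>. ennreal (noise_energy \<omega>) \<partial>joint_space) = ennreal (3 * \<sigma>\<^sub>1\<^sup>2)"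
    by (rule nn_integral_noise_energy)
  also have "ennreal G + ennreal B * emeasure joint_space bad_event + ennreal (3 * \<sigma>\<^sub>1\<^sup>2)
      = ennreal (G + B * measure joint_space bad_event + 3 * \<sigma>\<^sub>1\<^sup>2)"
    using nonneg by (simp add: joint.emeasure_eq_measure flip: ennreal_mult)
  finally show ?thesis
    unfolding G_def B_def .
qed

lemma error_bound_le_rate:
  "16 * (real s)\<^sup>2 * \<tau>\<^sup>2
      + (real p)\<^sup>2 * (8 + noise_weight) * measure joint_space bad_event + 3 * \<sigma>\<^sub>1\<^sup>2
    \<le> dp_error_const \<gamma> C1 * (real s)\<^sup>2 * rate"
proof -
  have "(real p)\<^sup>2 * (8 + noise_weight) * measure joint_space bad_event
      \<le> (real p)\<^sup>2 * (8 + noise_weight) * ((C1 + 2) / real p ^ 4)"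
    using prob_bad_event_le noise_weight_pos by (intro mult_left_mono) auto
  also have "\<dots> = (C1 + 2) * (8 * (1 / (real p)\<^sup>2) + \<sigma>\<^sub>1\<^sup>2)"
    using p_pos by (simp add: noise_weight_def field_simps eval_nat_numeral)
  also have "\<dots> \<le> (C1 + 2) * (8 * (10 * rate) + 4 * rate)"
    using inverse_p_square_le_rate sigma1_square_le_rate C1_pos
    by (intro mult_left_mono add_mono) auto
  finally have "(real p)\<^sup>2 * (8 + noise_weight) * measure joint_space bad_event + 3 * \<sigma>\<^sub>1\<^sup>2
      \<le> (84 * C1 + 180) * rate"
    using sigma1_square_le_rate by (simp add: algebra_simps)
  also have "\<dots> \<le> (real s)\<^sup>2 * ((84 * C1 + 180) * rate)"
    using s_ge_1 rate_nonneg C1_pos mult_right_mono[of 1 "(real s)\<^sup>2" "(84 * C1 + 180) * rate"]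
    by simp
  finally have "(real p)\<^sup>2 * (8 + noise_weight) * measure joint_space bad_event + 3 * \<sigma>\<^sub>1\<^sup>2
      \<le> (real s)\<^sup>2 * ((84 * C1 + 180) * rate)" .
  moreover have "16 * (real s)\<^sup>2 * \<tau>\<^sup>2 \<le> 16 * (real s)\<^sup>2 * ((10 * \<gamma>\<^sup>2 + 64) * rate)"
    using tau_square_le_rate by (intro mult_left_mono) auto
  ultimately show ?thesis by (simp add: dp_error_const_def algebra_simps)
qed

text \<open>The factor \<open>c\<close> is under the integral because \<open>hat_error\<close> is not known to be measurable.\<close>

lemma nn_integral_hat_error_square_le:
  "(\<integral>\<^sup>+\<omega>. c * ennreal ((hat_error \<omega>)\<^sup>2) \<partial>joint_space)
    \<le> c * ennreal (dp_error_const \<gamma> C1 * (real s)\<^sup>2 * rate)"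
proof -
  have "AE \<omega> in joint_space. \<forall>a<p. \<forall>b<p. \<bar>sample_cov n (fst \<omega>) a b\<bar> \<le> 1"
    by (rule AE_pair_fst[OF noise.prob_space_axioms AE_abs_sample_cov_le_1])
  then have "AE \<omega> in joint_space. c * ennreal ((hat_error \<omega>)\<^sup>2) \<le> c * ennreal (error_bound \<omega>)"
    using AE_space
    by eventually_elim (intro mult_left_mono ennreal_leI hat_error_square_le_error_bound, auto)
  then have "(\<integral>\<^sup>+\<omega>. c * ennreal ((hat_error \<omega>)\<^sup>2) \<partial>joint_space)
      \<le> (\<integral>\<^sup>+\<omega>. c * ennreal (error_bound \<omega>) \<partial>joint_space)"
    by (rule nn_integral_mono_AE)
  also have "\<dots> = c * (\<integral>\<^sup>+\<omega>. ennreal (error_bound \<omega>) \<partial>joint_space)"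
    by (intro nn_integral_cmult) measurable
  also have "\<dots> \<le> c * ennreal (dp_error_const \<gamma> C1 * (real s)\<^sup>2 * rate)"
    unfolding nn_integral_error_bound by (intro mult_left_mono ennreal_leI error_bound_le_rate) simp
  finally show ?thesis .
qed

lemma plus_error_le: "plus_error \<omega> \<le> 2 * hat_error \<omega>"
  unfolding dp_plus_def
  by (intro spec_norm_psd_part_le p_pos symmetric_mat_dp_hat psd_mat_cov_mat)

lemma expected_hat_error_square:
  "(\<integral>\<^sup>+\<omega>. ennreal ((hat_error \<omega>)\<^sup>2) \<partial>joint_space)
    \<le> ennreal (4 * dp_error_const \<gamma> C1 * (real s)\<^sup>2 * rate)"
proof -
  have "(\<integral>\<^sup>+\<omega>. ennreal ((hat_error \<omega>)\<^sup>2) \<partial>joint_space)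
      \<le> ennreal (dp_error_const \<gamma> C1 * (real s)\<^sup>2 * rate)"
    using nn_integral_hat_error_square_le[of 1] by simp
  also have "\<dots> \<le> ennreal (4 * dp_error_const \<gamma> C1 * (real s)\<^sup>2 * rate)"
    using C1_pos rate_nonneg
    by (intro ennreal_leI mult_right_mono) (simp_all add: dp_error_const_def)
  finally show ?thesis .
qed

lemma expected_plus_error_square:
  "(\<integral>\<^sup>+\<omega>. ennreal ((plus_error \<omega>)\<^sup>2) \<partial>joint_space)
    \<le> ennreal (4 * dp_error_const \<gamma> C1 * (real s)\<^sup>2 * rate)"
proof -
  have "ennreal ((plus_error \<omega>)\<^sup>2) \<le> 4 * ennreal ((hat_error \<omega>)\<^sup>2)" for \<omega>
  proof -
    have "(plus_error \<omega>)\<^sup>2 \<le> (2 * hat_error \<omega>)\<^sup>2"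
      by (intro power_mono plus_error_le spec_norm_nonneg p_pos)
    then have "ennreal ((plus_error \<omega>)\<^sup>2) \<le> ennreal (4 * (hat_error \<omega>)\<^sup>2)"
      by (intro ennreal_leI) (simp add: power_mult_distrib)
    then show ?thesis by (simp add: ennreal_mult'')
  qed
  then have "(\<integral>\<^sup>+\<omega>. ennreal ((plus_error \<omega>)\<^sup>2) \<partial>joint_space)
      \<le> (\<integral>\<^sup>+\<omega>. 4 * ennreal ((hat_error \<omega>)\<^sup>2) \<partial>joint_space)"
    by (intro nn_integral_mono)
  also have "\<dots> \<le> 4 * ennreal (dp_error_const \<gamma> C1 * (real s)\<^sup>2 * rate)"
    by (rule nn_integral_hat_error_square_le)
  also have "\<dots> = ennreal (4 * dp_error_const \<gamma> C1 * (real s)\<^sup>2 * rate)"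
    by (simp add: ennreal_mult' mult.assoc)
  finally show ?thesis .
qed

end

theorem theorem2:
  fixes sig2 \<gamma> C1 t0 :: real
  assumes "sig2 > 0" and "\<gamma> > 0" and "C1 > 0" and "t0 > 0"
  shows "\<exists>(C::real) (K::real). \<forall>(n::nat) (p::nat) (s::nat) (\<epsilon>::real) (\<delta>::real)
      (D :: (nat \<Rightarrow> real) measure).
    ( 1 \<le> n \<and> 2 \<le> p \<and> n \<le> p \<and> ln (real p) powr K \<le> real n \<and> 1 \<le> s
    \<and> 0 < \<epsilon> \<and> \<epsilon> \<le> 1 \<and> 0 < \<delta> \<and> \<delta> \<le> 1
    \<and> prob_space D \<and> sets D = sets (PiM {..<p} (\<lambda>_. borel :: real measure))
    \<and> (\<forall>i<p. (\<integral>x. x i \<partial>D) = 0)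
    \<and> (AE x in D. (\<Sum>i<p. (x i)\<^sup>2) \<le> 1)
    \<and> (\<forall>v. (\<Sum>i<p. (v i)\<^sup>2) = 1 \<longrightarrow> (\<forall>t>0.
          measure D {x \<in> space D. \<bar>\<Sum>i<p. v i * x i\<bar> > t} \<le> exp (- t\<^sup>2 / (2 * sig2))))
    \<and> in_G0 p s (cov_mat D)
    \<and> (\<forall>a<p. \<forall>b<p. \<forall>t. 0 < t \<and> t \<le> t0 \<longrightarrow>
          measure (sample_space D n) {X \<in> space (sample_space D n).
              \<bar>sample_cov n X a b - cov_mat D a b\<bar> > t}
            \<le> C1 * exp (- 8 * real n * t\<^sup>2 / \<gamma>\<^sup>2))
    \<and> (\<forall>a<p. \<forall>b<p.
          measure (sample_space D n) {X \<in> space (sample_space D n).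
              \<bar>sample_cov n X a b - cov_mat D a b\<bar> > \<gamma> * sqrt (ln (real p) / real n)}
            \<le> C1 * real p powr (-8)) )
    \<longrightarrow>
    (\<integral>\<^sup>+ \<omega>. ennreal ((spec_norm p (\<lambda>a b. dp_hat \<gamma> n p \<epsilon> \<delta> (fst \<omega>) (snd \<omega>) a b
              - cov_mat D a b))\<^sup>2)
        \<partial>(sample_space D n \<Otimes>\<^sub>M noise_space p (dp_sigma1 n \<epsilon> \<delta>)))
      \<le> ennreal (C * real s ^ 2 * ln (real p) * ln (1.25 / \<delta>) / (real n * \<epsilon>\<^sup>2))
    \<and>
    (\<integral>\<^sup>+ \<omega>. ennreal ((spec_norm p (\<lambda>a b. dp_plus \<gamma> n p \<epsilon> \<delta> (fst \<omega>) (snd \<omega>) a b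
              - cov_mat D a b))\<^sup>2)
        \<partial>(sample_space D n \<Otimes>\<^sub>M noise_space p (dp_sigma1 n \<epsilon> \<delta>)))
      \<le> ennreal (C * real s ^ 2 * ln (real p) * ln (1.25 / \<delta>) / (real n * \<epsilon>\<^sup>2))"
proof (intro exI[of _ "4 * dp_error_const \<gamma> C1"] exI[of _ 1] allI impI, elim conjE,
    goal_cases admissible)
  case (admissible n p s \<epsilon> \<delta> D)
  interpret dp_thresholding D p n s \<epsilon> \<delta> \<gamma> C1
    using admissible assms
    by (simp add: dp_thresholding_def dp_thresholding_axioms_def bounded_vector_def
        bounded_vector_axioms_def)
  show ?case
    using expected_hat_error_square expected_plus_error_square
    by (simp only: dp_rate_def times_divide_eq_right mult.assoc)
qed

end
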